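(* Consider the random access broadcast system with $N$ sources and $M$ indistinguishable destinations (described in the context), with arrival rates $\lambda_1,\dots,\lambda_N$, transmission probabilities $p_1,\dots,p_N\in(0,1)$ and single-transmission reception probabilities $q_{n|n}\in(0,1]$; let $\alpha_n$ be the constants defined in the context. Suppose the sources are indexed so that $$\frac{\lambda_1(1-p_1)}{\alpha_1p_1}\le\cdots\le\frac{\lambda_N(1-p_N)}{\alpha_Np_N}.$$ If the system is stable, then for all $k$ with $1\le k\le N$, $$\lambda_k\le\frac{\alpha_kp_k}{1-p_k}\left(\prod_{j=k}^N(1-p_j)-\frac{\sum_{i=1}^{k-1}\lambda_i}{\max_{1\le l\le k-1}\alpha_l}\right),$$ where for $k=1$ the fraction $\frac{\sum_{i=1}^{k-1}\lambda_i}{\max_{1\le l\le k-1}\alpha_l}$ is read as $0$.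
   Context: System. Time is slotted. There are $N$ sources $s_1,\dots,s_N$ and $M$ destinations. Packets arrive at $s_n$ according to a Bernoulli process of rate $\lambda_n$ packets per slot, i.i.d. over slots and independent across sources, and are stored in an infinite buffer. In each slot, a source with a nonempty queue transmits the packet at the head of its queue with probability $p_n$, independently; empty sources do not transmit. Every packet is intended for all $M$ destinations. If two or more sources transmit in the same slot, no transmission is received anywhere. If only $s_n$ transmits, each destination receives the packet with probability $q_{n|n}$ (the same for all destinations), independently across destinations. Acknowledgements are instantaneous and error-free. A packet is retransmitted (same random rule) until every destination has received it, possibly in different slots; it then completes service and leaves the queue. The queue lengths satisfy $Q_n(k+1)=(Q_n(k)-B_n(k))^+ + A_n(k)$, where $A_n(k)$ is the number of arrivals in slot $k$ and $B_n(k)\in\{0,1\}$ indicates a service completion in slot $k$. With $\mathbf Q(k)=(Q_1(k),\dots,Q_N(k))$, the system is stable if $\lim_{\mathbf x\to\infty}\lim_{k\to\infty}\Pr\{\mathbf Q(k)<\mathbf x\}=1$, $\mathbf x\in\mathbb N^N$ (componentwise inequality; equivalently, positive recurrence). Constants $\alpha_n$. Fix $n$ and write $q=q_{n|n}$. Let $\mathcal P^*$ be the transition matrix on states $\{0,1,\dots,M-1\}$ (number of destinations that have already received the current packet of $s_n$, observed at collision-free transmissions of $s_n$) given by $p^*_{0,0}=(1-q)^M+q^M$, $p^*_{i,0}=q^{M-i}$ for $0<i<M$, $p^*_{i,i}=(1-q)^{M-i}$ for $i>0$, $p^*_{i,j}=\binom{M-i}{j-i}q^{j-i}(1-q)^{M-j}$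 for $i<j$, and $p^*_{i,j}=0$ for $i>j>0$. Let $\pi=(\pi_0,\dots,\pi_{M-1})$ be its stationary distribution, $\pi=\pi\mathcal P^*$, i.e. $\pi_i=\frac{\sum_{j=0}^{i-1}\pi_jp^*_{j,i}}{1-p^*_{i,i}}$ for $1\le i\le M-1$ and $\sum_i\pi_i=1$. Then $$\alpha_n=\sum_{i=0}^{M-1}\pi_i\,q_{n|n}^{M-i}.$$ *)

theory Defs
  imports "HOL-Probability.Probability"
begin

section \<open>The random access broadcast system\<close>

text \<open>
  Sources are the indices \<open>n \<in> {1..N}\<close> and destinations the indices \<open>d \<in> {1..M}\<close>.
  A state \<open>(Q, S)\<close> consists of the queue lengths \<open>Q n\<close> and, for every source, the set
  \<open>S n\<close> of destinations that have already received the packet at the head of its queue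
  (\<open>S n\<close> is empty if no such packet exists or nobody has received it).
  Components of \<open>Q\<close> and \<open>S\<close> at indices outside \<open>{1..N}\<close> play no role.
\<close>

type_synonym state = "(nat \<Rightarrow> nat) \<times> (nat \<Rightarrow> nat set)"

definition sole_transmitter :: "nat \<Rightarrow> (nat \<Rightarrow> bool) \<Rightarrow> nat \<Rightarrow> bool" where
  "sole_transmitter N T n \<longleftrightarrow> T n \<and> (\<forall>m\<in>{1..N}. T m \<longrightarrow> m = n)"

definition transmissions :: "nat \<Rightarrow> (nat \<Rightarrow> real) \<Rightarrow> (nat \<Rightarrow> nat) \<Rightarrow> (nat \<Rightarrow> bool) pmf" where
  "transmissions N p Q =
     Pi_pmf {1..N} False (\<lambda>n. if 0 < Q n then bernoulli_pmf (p n) else return_pmf False)"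

definition receptions ::
    "nat \<Rightarrow> nat \<Rightarrow> (nat \<Rightarrow> real) \<Rightarrow> (nat \<Rightarrow> bool) \<Rightarrow> (nat \<times> nat \<Rightarrow> bool) pmf" where
  "receptions N M q T =
     Pi_pmf ({1..N} \<times> {1..M}) False
       (\<lambda>(n, d). if sole_transmitter N T n then bernoulli_pmf (q n) else return_pmf False)"

definition arrivals :: "nat \<Rightarrow> (nat \<Rightarrow> real) \<Rightarrow> (nat \<Rightarrow> bool) pmf" where
  "arrivals N lam = Pi_pmf {1..N} False (\<lambda>n. bernoulli_pmf (lam n))"

definition received :: "nat \<Rightarrow> (nat \<Rightarrow> nat set) \<Rightarrow> (nat \<times> nat \<Rightarrow> bool) \<Rightarrow> nat \<Rightarrow> nat set" where
  "received M S R n = S n \<union> {d \<in> {1..M}. R (n, d)}"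

definition completes :: "nat \<Rightarrow> state \<Rightarrow> (nat \<times> nat \<Rightarrow> bool) \<Rightarrow> nat \<Rightarrow> bool" where
  "completes M s R n \<longleftrightarrow> 0 < fst s n \<and> received M (snd s) R n = {1..M}"

text \<open>
  The truncated subtraction on \<^typ>\<open>nat\<close> is the positive part in
  \<open>Q(k+1) = (Q(k) - B(k))\<^sup>+ + A(k)\<close>. After a completion the next packet is fresh.
\<close>

definition next_state ::
    "nat \<Rightarrow> state \<Rightarrow> (nat \<Rightarrow> bool) \<Rightarrow> (nat \<times> nat \<Rightarrow> bool) \<Rightarrow> state" where
  "next_state M s A R =
     ((\<lambda>n. (fst s n - of_bool (completes M s R n)) + of_bool (A n)),
      (\<lambda>n. if completes M s R n then {} else received M (snd s) R n))"

definition slot ::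
    "nat \<Rightarrow> nat \<Rightarrow> (nat \<Rightarrow> real) \<Rightarrow> (nat \<Rightarrow> real) \<Rightarrow> (nat \<Rightarrow> real) \<Rightarrow> state \<Rightarrow> state pmf" where
  "slot N M lam p q s =
     bind_pmf (arrivals N lam) (\<lambda>A.
     bind_pmf (transmissions N p (fst s)) (\<lambda>T.
     bind_pmf (receptions N M q T) (\<lambda>R.
     return_pmf (next_state M s A R))))"

text \<open>
  Distribution of the state at the beginning of slot \<open>k\<close>; the initial queue lengths
  have distribution \<open>init\<close>, and initially no head-of-line packet has been received anywhere.
\<close>

primrec state_dist ::
    "nat \<Rightarrow> nat \<Rightarrow> (nat \<Rightarrow> real) \<Rightarrow> (nat \<Rightarrow> real) \<Rightarrow> (nat \<Rightarrow> real) \<Rightarrow>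
     (nat \<Rightarrow> nat) pmf \<Rightarrow> nat \<Rightarrow> state pmf" where
  "state_dist N M lam p q init 0 = map_pmf (\<lambda>Q. (Q, \<lambda>_. {})) init"
| "state_dist N M lam p q init (Suc k) =
     bind_pmf (state_dist N M lam p q init k) (slot N M lam p q)"

definition all_to_infinity :: "nat \<Rightarrow> (nat \<Rightarrow> nat) filter" where
  "all_to_infinity N = (\<Sqinter>n\<in>{1..N}. filtercomap (\<lambda>x. x n) at_top)"

definition system_stable ::
    "nat \<Rightarrow> nat \<Rightarrow> (nat \<Rightarrow> real) \<Rightarrow> (nat \<Rightarrow> real) \<Rightarrow> (nat \<Rightarrow> real) \<Rightarrow>
     (nat \<Rightarrow> nat) pmf \<Rightarrow> bool" where
  "system_stable N M lam p q init \<longleftrightarrow>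
     (\<exists>F :: (nat \<Rightarrow> nat) \<Rightarrow> real.
        (\<forall>x. (\<lambda>k. measure_pmf.prob (state_dist N M lam p q init k)
                   {s. \<forall>n\<in>{1..N}. fst s n < x n}) \<longlonglongrightarrow> F x) \<and>
        (F \<longlongrightarrow> 1) (all_to_infinity N))"


section \<open>The constants \<open>\<alpha>\<close>\<close>

definition Pstar :: "nat \<Rightarrow> real \<Rightarrow> nat \<Rightarrow> nat \<Rightarrow> real" where
  "Pstar M q i j =
     (if i = 0 \<and> j = 0 then (1 - q) ^ M + q ^ M
      else if j = 0 then q ^ (M - i)
      else if i = j then (1 - q) ^ (M - i)
      else if i < j then real ((M - i) choose (j - i)) * q ^ (j - i) * (1 - q) ^ (M - j)
      else 0)"

definition is_stationary :: "nat \<Rightarrow> real \<Rightarrow> (nat \<Rightarrow> real) \<Rightarrow> bool" where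
  "is_stationary M q \<pi> \<longleftrightarrow>
     (\<forall>i<M. 0 \<le> \<pi> i) \<and> (\<Sum>i<M. \<pi> i) = 1 \<and>
     (\<forall>j<M. \<pi> j = (\<Sum>i<M. \<pi> i * Pstar M q i j))"

text \<open>
  The convention \<open>\<pi> i = 0\<close> outside the state space \<open>{0..<M}\<close> makes the representing
  function unique; see \<open>ex1_stationary\<close> below.
\<close>

definition stationary :: "nat \<Rightarrow> real \<Rightarrow> nat \<Rightarrow> real" where
  "stationary M q = (THE \<pi>. is_stationary M q \<pi> \<and> (\<forall>i\<ge>M. \<pi> i = 0))"

definition alpha :: "nat \<Rightarrow> real \<Rightarrow> real" where
  "alpha M q = (\<Sum>i<M. stationary M q i * q ^ (M - i))"

lemma Pstar_row_sum:
  assumes "i < M"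
  shows "(\<Sum>j<M. Pstar M q i j) = 1"
proof -
  define b where "b j = real ((M - i) choose (j - i)) * q ^ (j - i) * (1 - q) ^ (M - j)" for j
  have P: "Pstar M q i j = (if j < i then 0 else b j) + (if j = 0 then q ^ (M - i) else 0)" for j
    by (auto simp: Pstar_def b_def)
  have "(\<Sum>j<M. Pstar M q i j)
      = (\<Sum>j<M. if j < i then 0 else b j) + (\<Sum>j<M. if j = 0 then q ^ (M - i) else 0)"
    by (simp add: P sum.distrib)
  also have "(\<Sum>j<M. if j = 0 then q ^ (M - i) else 0) = q ^ (M - i)"
    using assms by simp
  also have "(\<Sum>j<M. if j < i then 0 else b j) = (\<Sum>j\<in>{i..<M}. b j)"
    by (rule sum.mono_neutral_cong_right) auto
  also have "(\<Sum>j\<in>{i..<M}. b j) + q ^ (M - i) = (\<Sum>j\<in>{i..M}. b j)"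
    using assms by (subst sum.last_plus) (auto simp: b_def)
  also have "\<dots> = (\<Sum>t\<le>M - i. b (t + i))"
    by (rule sum.reindex_bij_witness[of _ "\<lambda>t. t + i" "\<lambda>j. j - i"]) (use assms in auto)
  also have "\<dots> = (\<Sum>t\<le>M - i. real ((M - i) choose t) * q ^ t * (1 - q) ^ (M - i - t))"
    by (simp add: b_def add.commute)
  also have "\<dots> = (q + (1 - q)) ^ (M - i)"
    by (rule binomial_ring [symmetric])
  finally show ?thesis by simp
qed

lemma Pstar_nonneg: "0 < q \<Longrightarrow> q \<le> 1 \<Longrightarrow> 0 \<le> Pstar M q i j"
  by (auto simp: Pstar_def)

lemma Pstar_diag_less_one:
  assumes "0 < q" "q \<le> 1" "0 < i" "i < M"
  shows "Pstar M q i i < 1"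
  using assms by (simp add: Pstar_def power_less_one_iff)

lemma Pstar_column:
  assumes "0 < j" "j < M"
  shows "(\<Sum>i<M. f i * Pstar M q i j) = (\<Sum>i<j. f i * Pstar M q i j) + f j * Pstar M q j j"
proof -
  have "(\<Sum>i<M. f i * Pstar M q i j) = (\<Sum>i<Suc j. f i * Pstar M q i j)"
    by (rule sum.mono_neutral_right) (use assms in \<open>auto simp: Pstar_def\<close>)
  then show ?thesis by simp
qed

lemma ex1_stationary:
  assumes M: "1 \<le> M" and q: "0 < q" "q \<le> 1"
  shows "\<exists>!\<pi>. is_stationary M q \<pi> \<and> (\<forall>i\<ge>M. \<pi> i = 0)"
proof -
  have "\<exists>u. \<forall>i. u i = (\<lambda>f i. if i = 0 then 1 else (\<Sum>j<i. f j * Pstar M q j i) / (1 - Pstar M q i i)) u i"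
  proof -
    define F :: "(nat \<Rightarrow> real) \<Rightarrow> nat \<Rightarrow> real"
      where "F = (\<lambda>f i. if i = 0 then 1 else (\<Sum>j<i. f j * Pstar M q j i) / (1 - Pstar M q i i))"
    have "adm_wf less_than F"
      unfolding adm_wf_def F_def by (auto intro!: arg_cong2[of _ _ _ _ "(/)"] sum.cong)
    then have "wfrec less_than F i = F (wfrec less_than F) i" for i
      by (rule fun_cong[OF wfrec_fixpoint[OF wf_less_than]])
    then show ?thesis unfolding F_def by blast
  qed
  then obtain u :: "nat \<Rightarrow> real" where
    u: "\<And>i. u i = (if i = 0 then 1 else (\<Sum>j<i. u j * Pstar M q j i) / (1 - Pstar M q i i))"
    by auto
  have u0: "u 0 = 1" by (subst u) simp
  have u_nonneg: "0 \<le> u i" if "i < M" for i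
    using that
  proof (induction i rule: less_induct)
    case (less i)
    show ?case
    proof (cases "i = 0")
      case False
      then have "u i = (\<Sum>j<i. u j * Pstar M q j i) / (1 - Pstar M q i i)"
        by (subst u) simp
      moreover have "0 \<le> (\<Sum>j<i. u j * Pstar M q j i)"
        using less by (intro sum_nonneg mult_nonneg_nonneg Pstar_nonneg q) auto
      ultimately show ?thesis
        using Pstar_diag_less_one[OF q, of i M] False less.prems by simp
    qed (simp add: u0)
  qed
  have u_col: "u j = (\<Sum>i<M. u i * Pstar M q i j)" if j: "0 < j" "j < M" for j
  proof -
    have "u j * (1 - Pstar M q j j) = (\<Sum>i<j. u i * Pstar M q i j)"
      using Pstar_diag_less_one[OF q j] j by (subst u) simp
    then show ?thesis
      unfolding Pstar_column[OF j] by (simp add: algebra_simps)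
  qed
  have split0: "(\<Sum>j<M. g j) = g 0 + (\<Sum>j\<in>{1..<M}. g j)" for g :: "nat \<Rightarrow> real"
    using M by (simp add: lessThan_atLeast0 sum.atLeast_Suc_lessThan)
  have "(\<Sum>j<M. \<Sum>i<M. u i * Pstar M q i j) = (\<Sum>i<M. u i)"
    by (subst sum.swap) (simp add: sum_distrib_left[symmetric] Pstar_row_sum)
  moreover have "(\<Sum>j\<in>{1..<M}. \<Sum>i<M. u i * Pstar M q i j) = (\<Sum>j\<in>{1..<M}. u j)"
    by (rule sum.cong) (auto simp: u_col[symmetric])
  ultimately have "u 0 = (\<Sum>i<M. u i * Pstar M q i 0)"
    by (simp add: split0[of "\<lambda>j. \<Sum>i<M. u i * Pstar M q i j"] split0[of u])
  with u_col have u_all: "u j = (\<Sum>i<M. u i * Pstar M q i j)" if "j < M" for j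
    using that by (cases "j = 0") auto
  define Z where "Z = (\<Sum>i<M. u i)"
  have Z: "0 < Z"
    unfolding Z_def split0[of u] u0 using u_nonneg by (intro add_pos_nonneg sum_nonneg) auto
  show ?thesis
  proof (rule ex1I)
    let ?\<pi> = "\<lambda>i. if i < M then u i / Z else 0"
    have total: "(\<Sum>i<M. ?\<pi> i) = 1"
      using Z by (simp add: sum_divide_distrib[symmetric] Z_def[symmetric])
    have balance: "?\<pi> j = (\<Sum>i<M. ?\<pi> i * Pstar M q i j)" if "j < M" for j
    proof -
      have "(\<Sum>i<M. ?\<pi> i * Pstar M q i j) = (\<Sum>i<M. u i * Pstar M q i j) / Z"
        unfolding sum_divide_distrib by (rule sum.cong) auto
      with that show ?thesis
        unfolding u_all[OF that, symmetric] by simp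
    qed
    have nonneg: "0 \<le> ?\<pi> i" if "i < M" for i
      using that u_nonneg Z by simp
    have "is_stationary M q ?\<pi>"
      unfolding is_stationary_def by (intro conjI allI impI nonneg total balance)
    then show "is_stationary M q ?\<pi> \<and> (\<forall>i\<ge>M. ?\<pi> i = 0)"
      by simp
  next
    fix \<pi>
    assume \<pi>: "is_stationary M q \<pi> \<and> (\<forall>i\<ge>M. \<pi> i = 0)"
    have pu: "\<pi> i = \<pi> 0 * u i" if "i < M" for i
      using that
    proof (induction i rule: less_induct)
      case (less i)
      show ?case
      proof (cases "i = 0")
        case False
        then have i: "0 < i" by simp
        have "\<pi> i = (\<Sum>j<M. \<pi> j * Pstar M q j i)"
          using \<pi> less.prems by (auto simp: is_stationary_def)
        then have "\<pi> i * (1 - Pstar M q i i) = (\<Sum>j<i. \<pi> j * Pstar M q j i)"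
          unfolding Pstar_column[OF i less.prems] by (simp add: algebra_simps)
        also have "\<dots> = \<pi> 0 * (\<Sum>j<i. u j * Pstar M q j i)"
          unfolding sum_distrib_left
        proof (rule sum.cong)
          fix j assume "j \<in> {..<i}"
          then have "\<pi> j = \<pi> 0 * u j"
            using less.IH[of j] less.prems by simp
          then show "\<pi> j * Pstar M q j i = \<pi> 0 * (u j * Pstar M q j i)"
            by (metis mult.assoc)
        qed simp
        also have "(\<Sum>j<i. u j * Pstar M q j i) = u i * (1 - Pstar M q i i)"
          using Pstar_diag_less_one[OF q i less.prems] i by (subst (2) u) simp
        finally show ?thesis
          using Pstar_diag_less_one[OF q i less.prems] by simp
      qed (simp add: u0)
    qed
    have "1 = (\<Sum>i<M. \<pi> i)"
      using \<pi> unfolding is_stationary_def by metis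
    also have "\<dots> = \<pi> 0 * Z"
      unfolding Z_def sum_distrib_left by (rule sum.cong) (auto intro: pu)
    finally have "\<pi> 0 = 1 / Z"
      using Z by (simp add: field_simps)
    then have "\<pi> i = (if i < M then u i / Z else 0)" for i
      using pu[of i] \<pi> by (cases "i < M") simp_all
    then show "\<pi> = (\<lambda>i. if i < M then u i / Z else 0)"
      by blast
  qed
qed

lemma is_stationary_stationary:
  assumes "1 \<le> M" "0 < q" "q \<le> 1"
  shows "is_stationary M q (stationary M q)"
  using theI'[OF ex1_stationary[OF assms]] by (simp add: stationary_def)

end

theory Submission
  imports Defs
begin

text \<open>
  Let \<open>W\<^sub>n\<close> be the mean number of collision-free transmissions that source \<open>n\<close> still needs to empty
  its queue, \<open>c\<^sub>n = p\<^sub>n / (1 - p\<^sub>n)\<close>, and \<open>Z\<close> the probability that nobody transmits. A packet needs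
  \<open>1 / \<alpha>\<^sub>n\<close> collision-free transmissions on average, so \<open>W\<^sub>n / c\<^sub>n\<close> has drift
  \<open>r\<^sub>n - Z\<close> if \<open>Q\<^sub>n > 0\<close>, where \<open>r\<^sub>n = \<lambda>\<^sub>n / (\<alpha>\<^sub>n c\<^sub>n)\<close>, and \<open>r\<^sub>n\<close> if \<open>Q\<^sub>n = 0\<close>. Suppose the bound fails
  at \<open>k\<close>. While all queues \<open>j \<ge> k\<close> are nonempty, at most one transmission by a source below \<open>k\<close> and
  none by the others has probability at most \<open>\<Prod>j\<ge>k. 1 - p\<^sub>j\<close>, whence
  \<open>W\<^sub>j / c\<^sub>j + (\<Sum>i<k. W\<^sub>i)\<close> has positive drift for \<open>j \<ge> k\<close>; and since the \<open>r\<^sub>n\<close> are sorted,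
  \<open>W\<^sub>j / c\<^sub>j - W\<^sub>i / c\<^sub>i\<close> has nonnegative drift for \<open>i < k\<close> with \<open>Q\<^sub>i > 0\<close>. A sum of exponentials of
  combinations of these functions is a Lyapunov function that contracts wherever it is small, and
  it is small only if all queues \<open>j \<ge> k\<close> are nonempty. Truncated, it is a bounded supermartingale
  with summable expected decrements. If the system were stable, the queues would be bounded with
  probability at least \<open>1/2\<close> at all late times, and from there the contracting region is
  reached with probability bounded below, so the decrements would not be summable.
\<close>

section \<open>Expectations and supermartingales over probability mass functions\<close>

lemma expectation_bind_pmf_finite:
  fixes h :: "'b \<Rightarrow> real"
  assumes "finite (set_pmf p)" "\<And>x. x \<in> set_pmf p \<Longrightarrow> finite (set_pmf (f x))"
  shows "measure_pmf.expectation (bind_pmf p f) h =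
           measure_pmf.expectation p (\<lambda>x. measure_pmf.expectation (f x) h)"
  using assms
  by (subst pmf_expectation_bind[of "set_pmf p"])
     (auto simp: integral_measure_pmf[of "set_pmf p"])

lemma expectation_bind_pmf_bounded:
  fixes f :: "'b \<Rightarrow> real"
  assumes "\<And>y. \<bar>f y\<bar> \<le> B"
  shows "measure_pmf.expectation (bind_pmf p K) f =
           measure_pmf.expectation p (\<lambda>x. measure_pmf.expectation (K x) f)"
  unfolding measure_pmf_bind
  by (rule integral_bind[where K="count_space UNIV" and B=B and B'=1])
     (use assms in \<open>auto simp: measure_pmf.emeasure_space_1
       measure_pmf_in_subprob_algebra\<close>)

lemma prob_bind_pmf_ge:
  assumes "0 \<le> c" "\<And>s. s \<in> E \<Longrightarrow> c \<le> measure_pmf.prob (K s) E'"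
  shows "c * measure_pmf.prob D E \<le> measure_pmf.prob (bind_pmf D K) E'"
proof -
  have "c * measure_pmf.prob D E = measure_pmf.expectation D (\<lambda>s. c * indicator E s)"
    by simp
  also have "\<dots> \<le> measure_pmf.expectation D (\<lambda>s. measure_pmf.prob (K s) E')"
    by (intro integral_mono measure_pmf.integrable_const_bound[where B=c]
          measure_pmf.integrable_const_bound[where B=1])
       (use assms in \<open>auto simp: indicator_def\<close>)
  also have "\<dots> = measure_pmf.prob (bind_pmf D K) E'"
    using expectation_bind_pmf_bounded[of "indicator E'" 1 D K] by (simp add: indicator_def)
  finally show ?thesis .
qed

lemma pmf_bind_ge: "pmf p x * pmf (f x) y \<le> pmf (bind_pmf p f) y"
  using prob_bind_pmf_ge[of "pmf (f x) y" "{x}" f "{y}" p]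
  by (simp add: measure_pmf_single mult.commute)

text \<open>Truncating \<open>U\<close> at the level \<open>u\<close> makes it a bounded supermartingale, whose expected
  decrements are summable.\<close>

lemma truncated_supermartingale_tendsto_0:
  fixes U :: "'a \<Rightarrow> real" and D :: "nat \<Rightarrow> 'a pmf"
  assumes step: "\<And>t. D (Suc t) = bind_pmf (D t) K"
    and U_nonneg: "\<And>s. 0 \<le> U s"
    and u: "0 \<le> u"
    and \<eta>: "0 < \<eta>"
    and finite: "\<And>s. finite (set_pmf (K s))"
    and drift: "\<And>t s. s \<in> set_pmf (D t) \<Longrightarrow> U s < u \<Longrightarrow>
                  measure_pmf.expectation (K s) U \<le> (1 - \<eta>) * U s"
  shows "(\<lambda>t. measure_pmf.expectation (D t) (\<lambda>s. if U s < u then U s else 0)) \<longlonglongrightarrow> 0"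
proof -
  define f where "f = (\<lambda>s. min (U s) u)"
  define g where "g = (\<lambda>s. if U s < u then U s else 0)"
  have f: "0 \<le> f s" "f s \<le> u" and g: "0 \<le> g s" "g s \<le> u" for s
    using U_nonneg[of s] u by (auto simp: f_def g_def)
  have int [simp]: "integrable (measure_pmf p) f" "integrable (measure_pmf p) g"
    "integrable (measure_pmf p) (\<lambda>s. measure_pmf.expectation (K s) f)" for p
    by (rule measure_pmf.integrable_const_bound[where B=u];
        use f g in \<open>auto intro!: AE_I2 measure_pmf.integral_le_const integral_nonneg_AE
          measure_pmf.integrable_const_bound[where B=u] simp: abs_of_nonneg\<close>)+
  define a b where "a = (\<lambda>t. measure_pmf.expectation (D t) f)"
    and "b = (\<lambda>t. measure_pmf.expectation (D t) g)"
  have nonneg: "0 \<le> a t" "0 \<le> b t" for t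
    unfolding a_def b_def using f g by (auto intro!: integral_nonneg_AE)
  have decrease: "a (Suc t) \<le> a t - \<eta> * b t" for t
  proof -
    have "a (Suc t) = measure_pmf.expectation (D t) (\<lambda>s. measure_pmf.expectation (K s) f)"
      unfolding a_def step by (rule expectation_bind_pmf_bounded[where B=u]) (use f in auto)
    also have "\<dots> \<le> measure_pmf.expectation (D t) (\<lambda>s. f s - \<eta> * g s)"
    proof (rule integral_mono_AE)
      show "AE s in D t. measure_pmf.expectation (K s) f \<le> f s - \<eta> * g s"
      proof (rule AE_pmfI)
        fix s assume s: "s \<in> set_pmf (D t)"
        show "measure_pmf.expectation (K s) f \<le> f s - \<eta> * g s"
        proof (cases "U s < u")
          case True
          have "measure_pmf.expectation (K s) f \<le> measure_pmf.expectation (K s) U"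
            by (rule integral_mono)
               (auto simp: f_def intro: integrable_measure_pmf_finite finite)
          with drift[OF s True] True show ?thesis
            by (simp add: f_def g_def algebra_simps)
        next
          case False
          have "measure_pmf.expectation (K s) f \<le> u"
            by (rule measure_pmf.integral_le_const) (use f in auto)
          with False show ?thesis by (simp add: f_def g_def)
        qed
      qed
    qed auto
    also have "\<dots> = a t - \<eta> * b t"
      unfolding a_def b_def by simp
    finally show ?thesis .
  qed
  have "(\<Sum>t<n. \<eta> * b t) \<le> a 0 - a n" for n
  proof (induction n)
    case (Suc n)
    with decrease[of n] show ?case unfolding sum.lessThan_Suc by linarith
  qed simp
  then have "(\<Sum>t<n. \<eta> * b t) \<le> a 0" for n
    using nonneg(1)[of n] by (smt (verit))
  then have "summable (\<lambda>t. \<eta> * b t)"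
    using nonneg \<eta> by (intro summableI_nonneg_bounded[where x="a 0"]) auto
  then have "(\<lambda>t. \<eta> * b t) \<longlonglongrightarrow> 0"
    by (rule summable_LIMSEQ_zero)
  then have "(\<lambda>t. inverse \<eta> * (\<eta> * b t)) \<longlonglongrightarrow> inverse \<eta> * 0"
    by (intro tendsto_intros)
  then show ?thesis
    using \<eta> by (simp add: b_def g_def)
qed

lemma exp_le_quadratic:
  fixes x :: real
  assumes "\<bar>x\<bar> \<le> 1"
  shows "exp x \<le> 1 + x + x\<^sup>2"
proof (cases "0 \<le> x")
  case True
  then show ?thesis using assms exp_bound by auto
next
  case False
  define y where "y = - x"
  have y: "0 \<le> y" "y \<le> 1" using False assms by (auto simp: y_def)
  \<comment> \<open>The product is \<open>1 + y^3\<close>; the next line uses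
    \<open>1 + y \<le> exp y\<close>.\<close>
  have "1 \<le> (1 - y + y\<^sup>2) * (1 + y)"
    using y by (simp add: algebra_simps power2_eq_square)
  also have "\<dots> \<le> (1 - y + y\<^sup>2) * exp y"
    using y by (intro mult_left_mono) (auto simp: exp_ge_add_one_self)
  finally have "exp (- y) \<le> 1 - y + y\<^sup>2"
    by (simp add: exp_minus field_simps)
  then show ?thesis by (simp add: y_def)
qed

text \<open>The drift \<open>d\<close> enters at first order in \<open>\<delta>\<close> and the
  jumps only at second, so for small \<open>\<delta>\<close> a positive drift of \<open>L\<close>
  makes \<open>exp (- \<delta> * L)\<close> contract in mean.\<close>

lemma expectation_exp_drift:
  fixes L :: "'a \<Rightarrow> real"
  assumes fin: "finite (set_pmf p)"
    and jump: "\<And>s'. s' \<in> set_pmf p \<Longrightarrow> \<bar>L s' - l\<bar> \<le> J"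
    and drift: "l + d \<le> measure_pmf.expectation p L"
    and \<delta>: "0 \<le> \<delta>" "\<delta> * J \<le> 1"
  shows "measure_pmf.expectation p (\<lambda>s'. exp (- \<delta> * L s')) \<le>
           (1 - \<delta> * d + (\<delta> * J)\<^sup>2) * exp (- \<delta> * l)"
proof -
  note int = integrable_measure_pmf_finite[OF fin]
  have "measure_pmf.expectation p (\<lambda>s'. exp (- \<delta> * L s')) \<le>
      measure_pmf.expectation p (\<lambda>s'. (1 - \<delta> * (L s' - l) + (\<delta> * J)\<^sup>2) * exp (- \<delta> * l))"
  proof (rule integral_mono_AE[OF int int], rule AE_pmfI)
    fix s' assume "s' \<in> set_pmf p"
    then have "\<bar>\<delta> * (L s' - l)\<bar> \<le> \<delta> * J"
      using jump \<delta> by (auto simp: abs_mult intro!: mult_left_mono)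
    then have "exp (- \<delta> * (L s' - l)) \<le> 1 - \<delta> * (L s' - l) + (\<delta> * (L s' - l))\<^sup>2"
      "(\<delta> * (L s' - l))\<^sup>2 \<le> (\<delta> * J)\<^sup>2"
      using exp_le_quadratic[of "- \<delta> * (L s' - l)"] \<delta> by (auto simp: abs_le_square_iff[symmetric])
    then have "exp (- \<delta> * (L s' - l)) \<le> 1 - \<delta> * (L s' - l) + (\<delta> * J)\<^sup>2"
      by simp
    then have "exp (- \<delta> * (L s' - l)) * exp (- \<delta> * l) \<le>
        (1 - \<delta> * (L s' - l) + (\<delta> * J)\<^sup>2) * exp (- \<delta> * l)"
      by (rule mult_right_mono) simp
    then show "exp (- \<delta> * L s') \<le> (1 - \<delta> * (L s' - l) + (\<delta> * J)\<^sup>2) * exp (- \<delta> * l)"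
      by (simp add: exp_add[symmetric] algebra_simps)
  qed
  also have "\<dots> = (1 - \<delta> * (measure_pmf.expectation p L - l) + (\<delta> * J)\<^sup>2) * exp (- \<delta> * l)"
    by (simp add: int Bochner_Integration.integral_diff measure_pmf.prob_space)
  also have "\<dots> \<le> (1 - \<delta> * d + (\<delta> * J)\<^sup>2) * exp (- \<delta> * l)"
    using drift \<delta> by (intro mult_right_mono) (auto intro!: mult_left_mono)
  finally show ?thesis .
qed

section \<open>Expected number of transmissions per packet\<close>

text \<open>The mean number of collision-free transmissions still needed when \<open>r\<close> destinations are
  missing.\<close>

fun rem :: "real \<Rightarrow> nat \<Rightarrow> real" where
  "rem q r = (if r = 0 then 0 else
     (1 + (\<Sum>s<r. real (r choose s) * (1 - q) ^ s * q ^ (r - s) * rem q s)) / (1 - (1 - q) ^ r))"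

declare rem.simps [simp del]

lemma rem_0 [simp]: "rem q 0 = 0"
  by (simp add: rem.simps)

lemma rem_nonneg:
  assumes "0 < q" "q \<le> 1"
  shows "0 \<le> rem q r"
proof (induction r rule: less_induct)
  case (less r)
  have "0 \<le> (\<Sum>s<r. real (r choose s) * (1 - q) ^ s * q ^ (r - s) * rem q s)"
    using assms less by (intro sum_nonneg mult_nonneg_nonneg) auto
  moreover have "(1 - q) ^ r \<le> 1"
    using assms by (intro power_le_one) auto
  ultimately show ?case
    by (subst rem.simps) auto
qed

text \<open>First-step equation: a collision-free transmission leaves a binomial number
  \<open>s\<close> of the \<open>r\<close> destinations missing. The definition of
  \<open>rem\<close> is this equation solved for \<open>rem q r\<close>, which also occurs on the
  right when nobody receives the packet.\<close>

lemma rem_eq: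
  assumes q: "0 < q" "q \<le> 1" and r: "0 < r"
  shows "rem q r = 1 + (\<Sum>s\<le>r. real (r choose s) * (1 - q) ^ s * q ^ (r - s) * rem q s)"
proof -
  have "(1 - q) ^ r < 1"
    using assms by (simp add: power_less_one_iff)
  then have "rem q r * (1 - (1 - q) ^ r) =
      1 + (\<Sum>s<r. real (r choose s) * (1 - q) ^ s * q ^ (r - s) * rem q s)"
    using r by (subst rem.simps) auto
  then show ?thesis
    by (simp add: lessThan_Suc_atMost[symmetric] algebra_simps)
qed

lemma rem_pos:
  assumes q: "0 < q" "q \<le> 1" and r: "0 < r"
  shows "0 < rem q r"
  unfolding rem_eq[OF assms] using q
  by (intro add_pos_nonneg sum_nonneg mult_nonneg_nonneg rem_nonneg) auto

text \<open>\<open>rem\<close> solves a Poisson equation for \<open>Pstar\<close>, which is integrated against the stationary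
  distribution.\<close>

lemma alpha_times_rem:
  assumes M: "1 \<le> M" and q: "0 < q" "q \<le> 1"
  shows "alpha M q * rem q M = 1"
proof -
  define \<pi> where "\<pi> = stationary M q"
  have \<pi>: "(\<Sum>i<M. \<pi> i) = 1" "\<And>j. j < M \<Longrightarrow> \<pi> j = (\<Sum>i<M. \<pi> i * Pstar M q i j)"
    using is_stationary_stationary[OF assms] by (auto simp: is_stationary_def \<pi>_def)
  define h where "h i = rem q (M - i)" for i
  \<comment> \<open>\<open>Pstar\<close> turns a completion into a return to state \<open>0\<close>,
    which adds \<open>q ^ (M - i) * h 0\<close> to the first-step equation.\<close>
  have poisson: "(\<Sum>j<M. Pstar M q i j * h j) = h i - 1 + q ^ (M - i) * h 0" if i: "i < M" for i
  proof -
    define b where "b j = real ((M - i) choose (j - i)) * q ^ (j - i) * (1 - q) ^ (M - j)" for j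
    have P: "Pstar M q i j = (if j < i then 0 else b j) + (if j = 0 then q ^ (M - i) else 0)" for j
      by (auto simp: Pstar_def b_def)
    have "(\<Sum>j<M. Pstar M q i j * h j)
        = (\<Sum>j<M. if j < i then 0 else b j * h j) + (\<Sum>j<M. if j = 0 then q ^ (M - i) * h j else 0)"
      unfolding sum.distrib[symmetric] by (rule sum.cong) (auto simp: P algebra_simps)
    also have "(\<Sum>j<M. if j = 0 then q ^ (M - i) * h j else 0) = q ^ (M - i) * h 0"
      using M by simp
    also have "(\<Sum>j<M. if j < i then 0 else b j * h j) = (\<Sum>j\<in>{i..M}. b j * h j)"
    proof -
      have "(\<Sum>j<M. if j < i then 0 else b j * h j) = (\<Sum>j\<in>{i..<M}. b j * h j)"
        by (rule sum.mono_neutral_cong_right) auto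
      \<comment> \<open>The term \<open>j = M\<close> may join, because
        \<open>h M = rem q 0 = 0\<close>.\<close>
      also have "\<dots> = (\<Sum>j\<in>{i..M}. b j * h j)"
        by (rule sum.mono_neutral_left) (auto simp: h_def)
      finally show ?thesis .
    qed
    also have "(\<Sum>j\<in>{i..M}. b j * h j) =
        (\<Sum>s\<le>M - i. real ((M - i) choose s) * (1 - q) ^ s * q ^ (M - i - s) * rem q s)"
    proof (rule sum.reindex_bij_witness[of _ "\<lambda>s. M - s" "\<lambda>j. M - j"])
      fix j assume j: "j \<in> {i..M}"
      then have "M - i - (M - j) = j - i" by auto
      then show "real ((M - i) choose (M - j)) * (1 - q) ^ (M - j) * q ^ (M - i - (M - j)) *
          rem q (M - j) = b j * h j"
        using j binomial_symmetric[of "j - i" "M - i"] diff_le_mono[of j M i] by (simp add: b_def h_def)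
    qed (use i in auto)
    also have "\<dots> = h i - 1"
      using rem_eq[OF q, of "M - i"] i by (simp add: h_def)
    finally show ?thesis by simp
  qed
  \<comment> \<open>Stationarity puts the same mean of \<open>h\<close> on both sides; cancelling it
    leaves \<open>alpha M q * rem q M = 1\<close>.\<close>
  have "(\<Sum>j<M. \<pi> j * h j) = (\<Sum>j<M. \<Sum>i<M. \<pi> i * (Pstar M q i j * h j))"
    by (rule sum.cong) (auto simp: \<pi>(2) sum_distrib_right mult.assoc)
  also have "\<dots> = (\<Sum>i<M. \<pi> i * (\<Sum>j<M. Pstar M q i j * h j))"
    by (subst sum.swap) (simp add: sum_distrib_left)
  also have "\<dots> = (\<Sum>i<M. \<pi> i * h i - \<pi> i + \<pi> i * q ^ (M - i) * h 0)"
    by (rule sum.cong) (simp_all add: poisson right_diff_distrib distrib_left mult.assoc)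
  also have "\<dots> = (\<Sum>i<M. \<pi> i * h i) - 1 + alpha M q * rem q M"
    by (simp add: sum.distrib sum_subtractf \<pi>(1) alpha_def \<pi>_def[symmetric] h_def
        sum_distrib_right[symmetric])
  finally show ?thesis by simp
qed

lemma alpha_pos:
  assumes "1 \<le> M" "0 < q" "q \<le> 1"
  shows "0 < alpha M q"
  using alpha_times_rem[OF assms] rem_pos[of q M] assms
  by (metis One_nat_def less_eq_Suc_le zero_less_mult_pos2 zero_less_one)

text \<open>\<open>A\<close> stands for the destinations still missing. The number of receptions is
  binomial, so by \<open>rem_eq\<close> a collision-free transmission lowers the mean remaining
  number by exactly one.\<close>

lemma expectation_rem_missing:
  assumes q: "0 < q" "q \<le> 1" and A: "finite A" "A \<noteq> {}"
  shows "measure_pmf.expectation (Pi_pmf A False (\<lambda>_. bernoulli_pmf q))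
           (\<lambda>R. rem q (card {x \<in> A. \<not> R x})) = rem q (card A) - 1"
proof -
  have card: "card {x \<in> A. \<not> R x} = card A - card {x \<in> A. R x}" for R
  proof -
    have "{x \<in> A. \<not> R x} = A - {x \<in> A. R x}" by auto
    then show ?thesis using A by (simp add: card_Diff_subset)
  qed
  have "measure_pmf.expectation (Pi_pmf A False (\<lambda>_. bernoulli_pmf q))
           (\<lambda>R. rem q (card {x \<in> A. \<not> R x})) =
        measure_pmf.expectation (binomial_pmf (card A) q) (\<lambda>k. rem q (card A - k))"
    using q A by (subst binomial_pmf_altdef'[where dflt=False, OF A(1) refl]) (auto simp: card)
  also have "\<dots> = (\<Sum>k\<le>card A. real (card A choose k) * q ^ k * (1 - q) ^ (card A - k) * rem q (card A - k))"
    using q by (subst expectation_binomial_pmf') auto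
  also have "\<dots> = (\<Sum>s\<le>card A. real (card A choose s) * (1 - q) ^ s * q ^ (card A - s) * rem q s)"
  proof (rule sum.reindex_bij_witness[of _ "\<lambda>s. card A - s" "\<lambda>k. card A - k"])
    fix k assume "k \<in> {..card A}"
    then show "real (card A choose (card A - k)) * (1 - q) ^ (card A - k) *
        q ^ (card A - (card A - k)) * rem q (card A - k) =
        real (card A choose k) * q ^ k * (1 - q) ^ (card A - k) * rem q (card A - k)"
      using binomial_symmetric[of k "card A"] by simp
  qed auto
  also have "\<dots> = rem q (card A) - 1"
    using rem_eq[OF q, of "card A"] A by (simp add: card_gt_0_iff)
  finally show ?thesis .
qed

section \<open>Drift of the workload of a source\<close>

text \<open>An invariant of the reachable states. The inclusion is strict because a packet received
  by every destination has already left.\<close>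

definition proper :: "nat \<Rightarrow> state \<Rightarrow> bool" where
  "proper M s \<longleftrightarrow> (\<forall>n. snd s n \<subset> {1..M} \<and> (fst s n = 0 \<longrightarrow> snd s n = {}))"

definition missing :: "nat \<Rightarrow> state \<Rightarrow> (nat \<times> nat \<Rightarrow> bool) \<Rightarrow> nat \<Rightarrow> nat set" where
  "missing M s R n = {d \<in> {1..M} - snd s n. \<not> R (n, d)}"

text \<open>The mean number of collision-free transmissions needed to empty the queue. The fresh packets
  contribute \<open>rem q M\<close> each, and the last two terms correct this for the packet at the head.\<close>

definition workload :: "nat \<Rightarrow> real \<Rightarrow> nat \<Rightarrow> state \<Rightarrow> real" where
  "workload M q n s =
     real (fst s n) * rem q M - (rem q M - rem q (M - card (snd s n)))"

definition silence :: "nat \<Rightarrow> (nat \<Rightarrow> real) \<Rightarrow> (nat \<Rightarrow> nat) \<Rightarrow> real" where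
  "silence N p Q = (\<Prod>m\<in>{1..N}. if 0 < Q m then 1 - p m else 1)"

lemma finite_set_Pi_pmf:
  assumes "finite A" "\<And>x. x \<in> A \<Longrightarrow> finite (set_pmf (p x))"
  shows "finite (set_pmf (Pi_pmf A dflt p))"
  using assms by (simp add: set_Pi_pmf finite_PiE_dflt)

lemma finite_set_arrivals: "finite (set_pmf (arrivals N lam))"
  by (auto simp: arrivals_def intro!: finite_set_Pi_pmf)

lemma finite_set_transmissions: "finite (set_pmf (transmissions N p Q))"
  by (auto simp: transmissions_def intro!: finite_set_Pi_pmf)

lemma finite_set_receptions: "finite (set_pmf (receptions N M q T))"
  by (auto simp: receptions_def intro!: finite_set_Pi_pmf)

lemmas finite_set_pmfs = finite_set_arrivals finite_set_transmissions finite_set_receptions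

lemma finite_set_slot: "finite (set_pmf (slot N M lam p q s))"
  by (simp add: slot_def finite_set_pmfs)

lemma transmissions_support:
  assumes "T \<in> set_pmf (transmissions N p Q)" "T n"
  shows "n \<in> {1..N}" "0 < Q n"
proof -
  have T: "T \<in> PiE_dflt {1..N} False
      (set_pmf \<circ> (\<lambda>n. if 0 < Q n then bernoulli_pmf (p n) else return_pmf False))"
    using assms(1) by (simp add: transmissions_def set_Pi_pmf)
  show n: "n \<in> {1..N}"
    using T assms(2) by (auto simp: PiE_dflt_def)
  show "0 < Q n"
    using T n assms(2) by (auto simp: PiE_dflt_def split: if_splits)
qed

lemma receptions_support:
  assumes "R \<in> set_pmf (receptions N M q T)" "R (n, d)"
  shows "n \<in> {1..N}" "sole_transmitter N T n"
proof -
  have R: "R \<in> PiE_dflt ({1..N} \<times> {1..M}) False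
      (set_pmf \<circ> (\<lambda>(n, d). if sole_transmitter N T n then bernoulli_pmf (q n) else return_pmf False))"
    using assms(1) by (simp add: receptions_def set_Pi_pmf)
  show n: "n \<in> {1..N}"
    using R assms(2) by (auto simp: PiE_dflt_def)
  have "(n, d) \<in> {1..N} \<times> {1..M}"
    using R assms(2) unfolding PiE_dflt_def by blast
  then show "sole_transmitter N T n"
    using R assms(2) by (force simp: PiE_dflt_def split: if_splits)
qed

text \<open>Sampled \<open>T\<close> are \<open>False\<close> outside \<open>{1..N}\<close>, so a
  sole transmission by \<open>n\<close> is a single sample point and its probability a value of
  \<open>pmf\<close>.\<close>

lemma sole_transmitter_iff:
  assumes "T \<in> set_pmf (transmissions N p Q)"
  shows "sole_transmitter N T n \<longleftrightarrow> T = (\<lambda>m. m = n)"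
  using transmissions_support[OF assms] unfolding sole_transmitter_def fun_eq_iff by blast

lemma receptions_empty_queue:
  assumes "T \<in> set_pmf (transmissions N p (fst s))" "R \<in> set_pmf (receptions N M q T)"
    "fst s n = 0"
  shows "\<not> R (n, d)"
  using receptions_support[OF assms(2), of n d] transmissions_support[OF assms(1), of n] assms(3)
  by (auto simp: sole_transmitter_def)

lemma set_slot_cases:
  assumes "s' \<in> set_pmf (slot N M lam p q s)"
  obtains A R where "s' = next_state M s A R" "\<And>n d. fst s n = 0 \<Longrightarrow> \<not> R (n, d)"
  using assms receptions_empty_queue by (auto simp: slot_def) metis

section \<open>Evolution of the workload in a slot\<close>

lemma completes_iff_missing:
  assumes "proper M s"
  shows "completes M s R n \<longleftrightarrow> 0 < fst s n \<and> missing M s R n = {}"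
  using assms by (auto simp: completes_def received_def missing_def proper_def)

lemma card_missing:
  assumes "proper M s"
  shows "card (missing M s R n) = M - card (received M (snd s) R n)"
proof -
  have "missing M s R n = {1..M} - received M (snd s) R n" "received M (snd s) R n \<subseteq> {1..M}"
    using assms by (auto simp: missing_def received_def proper_def)
  then show ?thesis
    by (simp add: card_Diff_subset finite_subset)
qed

lemma proper_next_state:
  assumes M: "1 \<le> M" and s: "proper M s" and R: "\<And>n d. fst s n = 0 \<Longrightarrow> \<not> R (n, d)"
  shows "proper M (next_state M s A R)"
  unfolding proper_def
proof (intro allI conjI impI)
  fix n
  have s: "snd s n \<subset> {1..M}" "fst s n = 0 \<Longrightarrow> snd s n = {}"
    using s by (auto simp: proper_def)
  have empty: "received M (snd s) R n = {}" if "fst s n = 0"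
    using that s(2) R[OF that] by (auto simp: received_def)
  show "snd (next_state M s A R) n \<subset> {1..M}"
    using M s empty by (auto simp: next_state_def completes_def received_def)
  assume "fst (next_state M s A R) n = 0"
  then show "snd (next_state M s A R) n = {}"
    using empty by (auto simp: next_state_def)
qed

lemma proper_slot:
  assumes "1 \<le> M" "proper M s" "s' \<in> set_pmf (slot N M lam p q s)"
  shows "proper M s'"
  using assms by (metis set_slot_cases proper_next_state)

lemma proper_state_dist:
  assumes "1 \<le> M" "s \<in> set_pmf (state_dist N M lam p q init t)"
  shows "proper M s"
  using assms(2)
proof (induction t arbitrary: s)
  case 0
  then show ?case using assms(1) by (auto simp: proper_def)
next
  case (Suc t)
  then obtain s0 where "s0 \<in> set_pmf (state_dist N M lam p q init t)"
    "s \<in> set_pmf (slot N M lam p q s0)" by auto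
  then show ?case using proper_slot[OF assms(1)] Suc.IH by blast
qed

lemma workload_nonneg:
  assumes "0 < q" "q \<le> 1" "proper M s"
  shows "0 \<le> workload M q n s"
proof (cases "fst s n")
  case 0
  then show ?thesis using assms by (simp add: workload_def proper_def)
next
  case (Suc m)
  then show ?thesis using rem_nonneg[OF assms(1,2)] by (simp add: workload_def algebra_simps)
qed

lemma workload_empty:
  assumes "proper M s" "fst s n = 0"
  shows "workload M q n s = 0"
  using assms by (simp add: workload_def proper_def)

text \<open>One formula covers both cases. At a completion nobody is missing and
  \<open>rem q 0 = 0\<close>; the queue is then nonempty, so subtracting one packet is exact, and
  the next head starts afresh.\<close>

lemma workload_next_state:
  assumes s: "proper M s" and R: "\<And>d. fst s n = 0 \<Longrightarrow> \<not> R (n, d)"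
  shows "workload M q n (next_state M s A R) = workload M q n s + of_bool (A n) * rem q M
           + rem q (card (missing M s R n)) - rem q (M - card (snd s n))"
proof (cases "completes M s R n")
  case True
  then show ?thesis
    using completes_iff_missing[OF s, of R n]
    by (simp add: workload_def next_state_def of_nat_diff algebra_simps)
next
  case False
  then show ?thesis
    using card_missing[OF s, of R n]
    by (simp add: workload_def next_state_def algebra_simps)
qed

definition rem_bound :: "real \<Rightarrow> nat \<Rightarrow> real" where
  "rem_bound q M = (\<Sum>r\<le>M. rem q r)"

lemma rem_le_bound:
  assumes "0 < q" "q \<le> 1" "r \<le> M"
  shows "rem q r \<le> rem_bound q M"
  unfolding rem_bound_def using assms by (intro member_le_sum) (auto simp: rem_nonneg)

lemma workload_jump:
  assumes q: "0 < q n" "q n \<le> 1" and s: "proper M s" "s' \<in> set_pmf (slot N M lam p q s)"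
  shows "\<bar>workload M (q n) n s' - workload M (q n) n s\<bar> \<le> 2 * rem_bound (q n) M"
proof -
  obtain A R where s': "s' = next_state M s A R" and R: "\<And>n d. fst s n = 0 \<Longrightarrow> \<not> R (n, d)"
    using set_slot_cases[OF s(2)] by blast
  have "card (missing M s R n) \<le> M"
    using card_missing[OF s(1), of R n] by simp
  note rem_le_bound[OF q this] rem_le_bound[OF q, of "M - card (snd s n)" M]
    rem_le_bound[OF q, of M M]
  then show ?thesis
    unfolding s' using workload_next_state[OF s(1), of n R "q n" A, OF R]
      rem_nonneg[OF q, of M] rem_nonneg[OF q, of "card (missing M s R n)"]
      rem_nonneg[OF q, of "M - card (snd s n)"]
    by (cases "A n") (auto simp: abs_le_iff)
qed

lemma expectation_slot:
  fixes h :: "state \<Rightarrow> real"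
  shows "measure_pmf.expectation (slot N M lam p q s) h =
    measure_pmf.expectation (arrivals N lam) (\<lambda>A.
    measure_pmf.expectation (transmissions N p (fst s)) (\<lambda>T.
    measure_pmf.expectation (receptions N M q T) (\<lambda>R. h (next_state M s A R))))"
  unfolding slot_def
  by (simp add: expectation_bind_pmf_finite finite_set_pmfs)

text \<open>Only the coordinates of \<open>n\<close> and its missing destinations count. The
  marginal of \<open>receptions\<close> on them is a product of Bernoulli laws, to which
  \<open>expectation_rem_missing\<close> applies.\<close>

lemma expectation_missing_sole:
  assumes q: "0 < q n" "q n \<le> 1" and n: "n \<in> {1..N}" and s: "proper M s"
    and T: "sole_transmitter N T n"
  shows "measure_pmf.expectation (receptions N M q T) (\<lambda>R. rem (q n) (card (missing M s R n))) =
           rem (q n) (M - card (snd s n)) - 1"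
proof -
  define B where "B = {n} \<times> ({1..M} - snd s n)"
  let ?K = "\<lambda>(n, d). if sole_transmitter N T n then bernoulli_pmf (q n) else return_pmf False"
  have B: "finite B" "B \<noteq> {}" "B \<subseteq> {1..N} \<times> {1..M}"
    using n s by (auto simp: B_def proper_def)
  have "snd s n \<subseteq> {1..M}"
    using s by (auto simp: proper_def)
  then have "card B = M - card (snd s n)"
    unfolding B_def by (simp add: card_cartesian_product card_Diff_subset finite_subset)
  have miss: "card (missing M s R n) = card {x \<in> B. \<not> (if x \<in> B then R x else False)}" for R
  proof -
    have "{x \<in> B. \<not> (if x \<in> B then R x else False)} = Pair n ` missing M s R n"
      by (auto simp: B_def missing_def)
    then show ?thesis by (simp add: card_image inj_on_def)
  qed
  have "Pi_pmf B False (\<lambda>_. bernoulli_pmf (q n)) = Pi_pmf B False ?K"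
    using T by (intro Pi_pmf_cong) (auto simp: B_def)
  also have "\<dots> = map_pmf (\<lambda>R x. if x \<in> B then R x else False) (receptions N M q T)"
    unfolding receptions_def using B by (intro Pi_pmf_subset) auto
  finally have map: "Pi_pmf B False (\<lambda>_. bernoulli_pmf (q n)) =
      map_pmf (\<lambda>R x. if x \<in> B then R x else False) (receptions N M q T)" .
  have "rem (q n) (card B) - 1 =
      measure_pmf.expectation (receptions N M q T) (\<lambda>R. rem (q n) (card (missing M s R n)))"
    unfolding expectation_rem_missing[OF q B(1,2), symmetric] map integral_map_pmf miss ..
  then show ?thesis
    using \<open>card B = _\<close> by simp
qed

text \<open>Given the transmissions, one unit of workload is served in mean exactly when
  \<open>n\<close> transmits alone; otherwise no reception concerns \<open>n\<close>.\<close>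

lemma expectation_workload_next_state:
  assumes q: "0 < q n" "q n \<le> 1" and n: "n \<in> {1..N}" and s: "proper M s"
    and T: "T \<in> set_pmf (transmissions N p (fst s))"
  shows "measure_pmf.expectation (receptions N M q T) (\<lambda>R. workload M (q n) n (next_state M s A R)) =
           workload M (q n) n s + of_bool (A n) * rem (q n) M - of_bool (T = (\<lambda>m. m = n))"
proof -
  let ?r = "rem (q n) (M - card (snd s n))"
  note int = integrable_measure_pmf_finite[OF finite_set_receptions]
  have "measure_pmf.expectation (receptions N M q T) (\<lambda>R. workload M (q n) n (next_state M s A R)) =
      measure_pmf.expectation (receptions N M q T) (\<lambda>R.
        workload M (q n) n s + of_bool (A n) * rem (q n) M - ?r + rem (q n) (card (missing M s R n)))"
    by (intro integral_cong_AE AE_pmfI)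
       (auto simp: workload_next_state[OF s] receptions_empty_queue[OF T])
  also have "\<dots> = workload M (q n) n s + of_bool (A n) * rem (q n) M - ?r +
      measure_pmf.expectation (receptions N M q T) (\<lambda>R. rem (q n) (card (missing M s R n)))"
    by (subst Bochner_Integration.integral_add[OF int int]) simp
  also have "measure_pmf.expectation (receptions N M q T) (\<lambda>R. rem (q n) (card (missing M s R n))) =
      ?r - of_bool (T = (\<lambda>m. m = n))"
  proof (cases "sole_transmitter N T n")
    case True
    then show ?thesis
      using expectation_missing_sole[where q=q and n=n, OF q n s True] sole_transmitter_iff[OF T] by simp
  next
    case False
    have "measure_pmf.expectation (receptions N M q T) (\<lambda>R. rem (q n) (card (missing M s R n))) =
        measure_pmf.expectation (receptions N M q T) (\<lambda>R. ?r)"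
    proof (intro integral_cong_AE AE_pmfI)
      fix R assume "R \<in> set_pmf (receptions N M q T)"
      then have "received M (snd s) R n = snd s n"
        using receptions_support(2) False by (auto simp: received_def)
      then show "rem (q n) (card (missing M s R n)) = ?r"
        using card_missing[OF s, of R n] by simp
    qed auto
    then show ?thesis
      using False sole_transmitter_iff[OF T] by simp
  qed
  finally show ?thesis by simp
qed

lemma pmf_transmissions_silent:
  assumes "\<And>m. m \<in> {1..N} \<Longrightarrow> 0 < p m \<and> p m < 1"
  shows "pmf (transmissions N p Q) (\<lambda>_. False) = silence N p Q"
  unfolding transmissions_def silence_def using assms
  by (subst pmf_Pi') (auto intro!: prod.cong simp: less_imp_le)

text \<open>Compared with silence, only the factor of a nonempty \<open>n\<close> changes, from
  \<open>1 - p n\<close> to \<open>p n\<close>; this is the origin of the odds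
  \<open>p n / (1 - p n)\<close>.\<close>

lemma pmf_transmissions_sole:
  assumes p: "\<And>m. m \<in> {1..N} \<Longrightarrow> 0 < p m \<and> p m < 1" and n: "n \<in> {1..N}"
  shows "pmf (transmissions N p Q) (\<lambda>m. m = n) =
           p n / (1 - p n) * of_bool (0 < Q n) * silence N p Q"
proof -
  let ?f = "\<lambda>m. pmf (if 0 < Q m then bernoulli_pmf (p m) else return_pmf False) (m = n)"
  let ?g = "\<lambda>m. if 0 < Q m then 1 - p m else 1"
  have "pmf (transmissions N p Q) (\<lambda>m. m = n) = (\<Prod>m\<in>{1..N}. ?f m)"
    unfolding transmissions_def using n by (subst pmf_Pi') auto
  also have "\<dots> = ?f n * (\<Prod>m\<in>{1..N} - {n}. ?f m)"
    using n by (subst prod.remove[of _ n]) auto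
  also have "(\<Prod>m\<in>{1..N} - {n}. ?f m) = (\<Prod>m\<in>{1..N} - {n}. ?g m)"
    using p by (intro prod.cong) (auto simp: less_imp_le)
  also have "?f n * \<dots> = p n / (1 - p n) * of_bool (0 < Q n) * (?g n * (\<Prod>m\<in>{1..N} - {n}. ?g m))"
    using p[OF n] by auto
  also have "?g n * (\<Prod>m\<in>{1..N} - {n}. ?g m) = silence N p Q"
    unfolding silence_def using n by (subst (2) prod.remove[of _ n]) auto
  finally show ?thesis .
qed

lemma expectation_workload_slot:
  assumes q: "0 < q n" "q n \<le> 1" and n: "n \<in> {1..N}" and s: "proper M s"
    and p: "\<And>m. m \<in> {1..N} \<Longrightarrow> 0 < p m \<and> p m < 1" and lam: "0 \<le> lam n" "lam n \<le> 1"
  shows "measure_pmf.expectation (slot N M lam p q s) (workload M (q n) n) =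
     workload M (q n) n s + lam n * rem (q n) M
       - p n / (1 - p n) * of_bool (0 < fst s n) * silence N p (fst s)"
proof -
  let ?w = "workload M (q n) n s" and ?g = "rem (q n) M"
  let ?T = "transmissions N p (fst s)" and ?A = "arrivals N lam"
  note int = integrable_measure_pmf_finite[OF finite_set_transmissions]
    integrable_measure_pmf_finite[OF finite_set_arrivals]
  have ind: "measure_pmf.expectation ?T (\<lambda>T. of_bool (T = (\<lambda>m. m = n))) = pmf ?T (\<lambda>m. m = n)"
  proof -
    have "(\<lambda>T. of_bool (T = (\<lambda>m. m = n))) = (indicator {\<lambda>m. m = n} :: _ \<Rightarrow> real)"
      by (auto simp: indicator_def fun_eq_iff)
    then show ?thesis by (simp add: measure_pmf_single)
  qed
  have arr: "measure_pmf.expectation ?A (\<lambda>A. of_bool (A n)) = lam n"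
  proof -
    have "measure_pmf.expectation ?A (\<lambda>A. of_bool (A n) :: real) =
        measure_pmf.expectation (map_pmf (\<lambda>A. A n) ?A) of_bool"
      by (rule integral_map_pmf[symmetric])
    also have "map_pmf (\<lambda>A. A n) ?A = bernoulli_pmf (lam n)"
      unfolding arrivals_def using n by (subst Pi_pmf_component) auto
    finally show ?thesis using lam by simp
  qed
  have "measure_pmf.expectation (slot N M lam p q s) (workload M (q n) n) =
      measure_pmf.expectation ?A (\<lambda>A. measure_pmf.expectation ?T (\<lambda>T.
        ?w + of_bool (A n) * ?g - of_bool (T = (\<lambda>m. m = n))))"
    unfolding expectation_slot
    by (intro Bochner_Integration.integral_cong integral_cong_AE AE_pmfI)
       (auto simp: expectation_workload_next_state[where q=q and n=n, OF q n s])
  also have "\<dots> = measure_pmf.expectation ?A (\<lambda>A. ?w + of_bool (A n) * ?g - pmf ?T (\<lambda>m. m = n))"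
    by (subst Bochner_Integration.integral_diff[OF int(1) int(1)]) (simp add: ind)
  also have "\<dots> = ?w + lam n * ?g - pmf ?T (\<lambda>m. m = n)"
    by (simp add: int(2) arr Bochner_Integration.integral_diff Bochner_Integration.integral_add)
  finally show ?thesis
    using pmf_transmissions_sole[OF p n] by simp
qed

section \<open>An overloaded set of sources\<close>

text \<open>For independent events of probabilities \<open>u i\<close>, the left side is the
  probability that at most one of them occurs.\<close>

lemma prod_one_minus_times_odds_le_1:
  fixes u :: "'a \<Rightarrow> real"
  assumes "finite A" "\<And>i. i \<in> A \<Longrightarrow> 0 \<le> u i \<and> u i < 1"
  shows "(\<Prod>i\<in>A. 1 - u i) * (1 + (\<Sum>i\<in>A. u i / (1 - u i))) \<le> 1"
  using assms
proof (induction A rule: finite_induct)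
  case (insert a A)
  let ?P = "\<Prod>i\<in>A. 1 - u i" and ?S = "1 + (\<Sum>i\<in>A. u i / (1 - u i))"
  have u: "0 \<le> u a" "u a < 1" using insert.prems by auto
  have "?P \<le> 1"
    using insert.prems by (intro prod_le_1) (auto simp: less_imp_le)
  \<comment> \<open>Conditioning on event \<open>a\<close>: without it at most one event of
    \<open>A\<close> may occur, with it none.\<close>
  then have "(1 - u a) * (?P * ?S) + u a * ?P \<le> (1 - u a) * 1 + u a * 1"
    using insert u by (intro add_mono mult_left_mono) (auto simp: less_imp_le)
  moreover have "(1 - u a) * (?P * ?S) + u a * ?P =
      (1 - u a) * ?P * (?S + u a / (1 - u a))"
    using u by (simp add: field_simps)
  ultimately show ?case
    using insert by (simp add: algebra_simps)
qed simp

lemma ex_nat_times_exp_less: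
  fixes a b c :: real
  assumes "0 < b" "0 < c"
  shows "\<exists>m::nat. a * exp (- (b * real m)) < c"
proof -
  obtain m :: nat where "a / (b * c) < real m"
    using reals_Archimedean2 by blast
  then have "a < c * (b * real m)"
    using assms by (simp add: field_simps)
  also have "\<dots> \<le> c * exp (b * real m)"
    using assms exp_ge_add_one_self[of "b * real m"] by (intro mult_left_mono) linarith+
  finally show ?thesis
    by (auto simp: exp_minus field_simps)
qed

text \<open>Failure of the bound at \<open>k\<close>, written with
  \<open>rem (q n) M = 1 / alpha M (q n)\<close>. Each source below \<open>k\<close> enters with its
  own constant in place of the maximum, so \<open>overload\<close> is a weaker assumption than that
  failure.\<close>

locale overload_at =
  fixes N M k :: nat and lam p q :: "nat \<Rightarrow> real"
  assumes M: "1 \<le> M" and k: "k \<in> {1..N}"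
    and lam: "\<And>n. n \<in> {1..N} \<Longrightarrow> 0 \<le> lam n \<and> lam n \<le> 1"
    and p: "\<And>n. n \<in> {1..N} \<Longrightarrow> 0 < p n \<and> p n < 1"
    and q: "\<And>n. n \<in> {1..N} \<Longrightarrow> 0 < q n \<and> q n \<le> 1"
    and load_mono: "mono_on {1..N} (\<lambda>n. lam n * rem (q n) M * (1 - p n) / p n)"
    and overload: "(\<Prod>j\<in>{k..N}. 1 - p j) <
      lam k * rem (q k) M * (1 - p k) / p k + (\<Sum>i\<in>{1..<k}. lam i * rem (q i) M)"
begin

definition odds where "odds n = p n / (1 - p n)"

definition load where "load n = lam n * rem (q n) M / odds n"

text \<open>After division by \<open>odds n\<close>, every busy source is served at the same mean
  rate, the silence probability.\<close>

definition backlog where "backlog n s = workload M (q n) n s / odds n"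

definition low_work where "low_work s = (\<Sum>i\<in>{1..<k}. odds i * backlog i s)"

definition low_odds where "low_odds = (\<Sum>i\<in>{1..<k}. odds i)"

text \<open>Chosen such that \<open>\<theta> * (1 + low_odds) = 1 / 2\<close>: then
  \<open>(1 - \<theta>) * backlog l s\<close> outweighs \<open>\<theta> * low_work s\<close> for the
  fullest source \<open>l\<close> below \<open>k\<close>.\<close>

definition \<theta> where "\<theta> = 1 / (2 * (1 + low_odds))"

definition excess where
  "excess = load k + (\<Sum>i\<in>{1..<k}. odds i * load i) - (\<Prod>j\<in>{k..N}. 1 - p j)"

text \<open>While all sources \<open>j \<ge> k\<close> are backlogged, \<open>potential K j 0\<close> always has positive drift, and
  \<open>potential K j b\<close> has positive drift as long as source \<open>b\<close> is backlogged: the silence probability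
  cancels in the drift of \<open>backlog j - backlog b\<close>. A large value of all these potentials forces
  \<open>backlog j\<close> to be positive, which would not follow from \<open>potential K j 0\<close> alone.\<close>

definition potential where
  "potential K j b s =
     (if b = 0 then backlog j s + low_work s
      else K + (1 - \<theta>) * (backlog j s - backlog b s) + \<theta> * (backlog j s + low_work s))"

text \<open>A smooth stand-in for the minimum of the potentials: it is small exactly when all of
  them are large. The index \<open>b = 0\<close> is no source and selects the plain sum.\<close>

definition lyapunov where
  "lyapunov \<delta> K s = (\<Sum>j\<in>{k..N}. \<Sum>b\<in>{0..<k}. exp (- \<delta> * potential K j b s))"

section \<open>Signs and bounds of the constants\<close>

lemma index_range:
  "i \<in> {1..<k} \<Longrightarrow> i \<in> {1..N}" "j \<in> {k..N} \<Longrightarrow> j \<in> {1..N}"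
  using k by auto

lemma odds_pos: "n \<in> {1..N} \<Longrightarrow> 0 < odds n"
  using p by (auto simp: odds_def)

lemma rem_pos': "n \<in> {1..N} \<Longrightarrow> 0 < rem (q n) M"
  using q M by (intro rem_pos) auto

lemma load_nonneg: "n \<in> {1..N} \<Longrightarrow> 0 \<le> load n"
  using lam rem_pos' odds_pos by (simp add: load_def less_imp_le)

lemma odds_times_load: "n \<in> {1..N} \<Longrightarrow> odds n * load n = lam n * rem (q n) M"
  using odds_pos[of n] by (simp add: load_def)

lemma load_le: "i \<in> {1..N} \<Longrightarrow> j \<in> {1..N} \<Longrightarrow> i \<le> j \<Longrightarrow> load i \<le> load j"
  using mono_onD[OF load_mono, of i j] by (simp add: load_def odds_def)

lemma low_odds_nonneg: "0 \<le> low_odds"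
  unfolding low_odds_def using odds_pos index_range by (intro sum_nonneg) (auto simp: less_imp_le)

lemma \<theta>: "0 < \<theta>" "\<theta> \<le> 1 / 2" "\<theta> * (1 + low_odds) = 1 / 2"
  using low_odds_nonneg by (auto simp: \<theta>_def field_simps)

lemma excess_pos: "0 < excess"
proof -
  have "(\<Sum>i\<in>{1..<k}. odds i * load i) = (\<Sum>i\<in>{1..<k}. lam i * rem (q i) M)"
    using odds_times_load index_range by (intro sum.cong) auto
  then show ?thesis
    using overload by (simp add: excess_def load_def odds_def)
qed

text \<open>If \<open>load k\<close> vanished, the ordering would make all loads below
  \<open>k\<close> vanish too, and \<open>excess\<close> could not be positive.\<close>

lemma load_pos:
  assumes j: "j \<in> {k..N}"
  shows "0 < load j"
proof -
  have "0 < load k"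
  proof (rule ccontr)
    assume neg: "\<not> 0 < load k"
    have "odds i * load i = 0" if "i \<in> {1..<k}" for i
      using load_le[of i k] load_nonneg[of i] neg index_range(1)[OF that] k that by auto
    then have "(\<Sum>i\<in>{1..<k}. odds i * load i) = 0"
      by (intro sum.neutral) auto
    moreover have "0 \<le> (\<Prod>j\<in>{k..N}. 1 - p j)"
      using p index_range by (intro prod_nonneg) (auto simp: less_imp_le)
    ultimately show False
      using excess_pos neg unfolding excess_def by linarith
  qed
  then show ?thesis
    using load_le[of k j] j k by auto
qed

lemma lam_pos: "j \<in> {k..N} \<Longrightarrow> 0 < lam j"
  using load_pos[of j] lam[of j] index_range(2)[of j] by (auto simp: load_def order_le_less)

lemma backlog_nonneg: "n \<in> {1..N} \<Longrightarrow> proper M s \<Longrightarrow> 0 \<le> backlog n s"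
  using workload_nonneg[of "q n" M s n] q[of n] odds_pos[of n] by (simp add: backlog_def)

lemma backlog_empty: "proper M s \<Longrightarrow> fst s n = 0 \<Longrightarrow> backlog n s = 0"
  by (simp add: backlog_def workload_empty)

lemma low_work_nonneg: "proper M s \<Longrightarrow> 0 \<le> low_work s"
  unfolding low_work_def using odds_pos backlog_nonneg index_range
  by (intro sum_nonneg mult_nonneg_nonneg) (auto simp: less_imp_le)

lemma low_work_le:
  assumes "\<And>i. i \<in> {1..<k} \<Longrightarrow> backlog i s \<le> y"
  shows "low_work s \<le> low_odds * y"
  unfolding low_work_def low_odds_def sum_distrib_right
  using assms odds_pos index_range by (intro sum_mono mult_left_mono) (auto simp: less_imp_le)

text \<open>The left side is the probability that no source from \<open>k\<close> on and at most one
  below \<open>k\<close> transmits; the right side drops the second condition.\<close>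

lemma silence_bound:
  assumes "\<And>j. j \<in> {k..N} \<Longrightarrow> 0 < Q j"
  shows "silence N p Q * (1 + (\<Sum>i\<in>{1..<k}. odds i * of_bool (0 < Q i))) \<le> (\<Prod>j\<in>{k..N}. 1 - p j)"
proof -
  \<comment> \<open>An empty source counts as one that transmits with probability
    \<open>0\<close>.\<close>
  let ?u = "\<lambda>i. p i * of_bool (0 < Q i)"
  have split: "{1..N} = {1..<k} \<union> {k..N}" using k by auto
  have "silence N p Q = (\<Prod>m\<in>{1..<k}. if 0 < Q m then 1 - p m else 1) *
      (\<Prod>m\<in>{k..N}. if 0 < Q m then 1 - p m else 1)"
    unfolding silence_def split by (rule prod.union_disjoint) auto
  also have "(\<Prod>m\<in>{k..N}. if 0 < Q m then 1 - p m else 1) = (\<Prod>j\<in>{k..N}. 1 - p j)"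
    using assms by (intro prod.cong) auto
  also have "(\<Prod>m\<in>{1..<k}. if 0 < Q m then 1 - p m else 1) = (\<Prod>m\<in>{1..<k}. 1 - ?u m)"
    by (intro prod.cong) auto
  finally have silence: "silence N p Q = (\<Prod>m\<in>{1..<k}. 1 - ?u m) * (\<Prod>j\<in>{k..N}. 1 - p j)" .
  have sum: "(\<Sum>i\<in>{1..<k}. odds i * of_bool (0 < Q i)) = (\<Sum>i\<in>{1..<k}. ?u i / (1 - ?u i))"
    by (intro sum.cong) (auto simp: odds_def)
  have "(\<Prod>m\<in>{1..<k}. 1 - ?u m) * (1 + (\<Sum>i\<in>{1..<k}. ?u i / (1 - ?u i))) \<le> 1"
    using p index_range by (intro prod_one_minus_times_odds_le_1) (auto simp: less_imp_le)
  moreover have "0 \<le> (\<Prod>j\<in>{k..N}. 1 - p j)"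
    using p index_range by (intro prod_nonneg) (auto simp: less_imp_le)
  ultimately show ?thesis
    unfolding silence sum using mult_left_mono[where c="\<Prod>j\<in>{k..N}. 1 - p j"]
    by (fastforce simp: mult_ac)
qed

section \<open>Drift and jumps of the potentials\<close>

abbreviation K_slot where "K_slot \<equiv> slot N M lam p q"

lemma integrable_slot: "integrable (measure_pmf (K_slot s)) (f :: state \<Rightarrow> real)"
  by (intro integrable_measure_pmf_finite finite_set_slot)

lemma expectation_backlog:
  assumes n: "n \<in> {1..N}" and s: "proper M s"
  shows "measure_pmf.expectation (K_slot s) (backlog n) =
           backlog n s + load n - of_bool (0 < fst s n) * silence N p (fst s)"
proof -
  have "measure_pmf.expectation (K_slot s) (backlog n) =
      measure_pmf.expectation (K_slot s) (workload M (q n) n) / odds n"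
    unfolding backlog_def by simp
  also have "\<dots> = (workload M (q n) n s + lam n * rem (q n) M
      - odds n * of_bool (0 < fst s n) * silence N p (fst s)) / odds n"
    using expectation_workload_slot[where q=q and n=n and lam=lam and p=p, of N M s] n s q[OF n] p lam[OF n]
    by (simp add: odds_def)
  also have "\<dots> = backlog n s + load n - of_bool (0 < fst s n) * silence N p (fst s)"
    using odds_pos[OF n] by (simp add: backlog_def load_def diff_divide_distrib add_divide_distrib)
  finally show ?thesis .
qed

lemma expectation_low_work:
  assumes s: "proper M s"
  shows "measure_pmf.expectation (K_slot s) low_work = low_work s +
     (\<Sum>i\<in>{1..<k}. odds i * load i) -
     silence N p (fst s) * (\<Sum>i\<in>{1..<k}. odds i * of_bool (0 < fst s i))"
proof -
  have "measure_pmf.expectation (K_slot s) low_work =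
      (\<Sum>i\<in>{1..<k}. odds i * measure_pmf.expectation (K_slot s) (backlog i))"
    unfolding low_work_def by (simp add: integrable_slot)
  also have "\<dots> = (\<Sum>i\<in>{1..<k}. odds i * backlog i s + odds i * load i -
      silence N p (fst s) * (odds i * of_bool (0 < fst s i)))"
    using index_range by (intro sum.cong) (auto simp: expectation_backlog s algebra_simps)
  finally show ?thesis
    unfolding sum.distrib sum_subtractf low_work_def sum_distrib_left[symmetric] .
qed

lemma expectation_potential_0:
  assumes j: "j \<in> {k..N}" and s: "proper M s" and busy: "\<And>j. j \<in> {k..N} \<Longrightarrow> 0 < fst s j"
  shows "backlog j s + low_work s + excess \<le>
           measure_pmf.expectation (K_slot s) (\<lambda>s. backlog j s + low_work s)"
proof -
  let ?Z = "silence N p (fst s)"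
  let ?O = "\<Sum>i\<in>{1..<k}. odds i * of_bool (0 < fst s i)"
  have "?Z * (1 + ?O) \<le> (\<Prod>j\<in>{k..N}. 1 - p j)" "load k \<le> load j"
    using silence_bound[OF busy] load_le[of k j] j k by auto
  then show ?thesis
    using expectation_backlog[OF index_range(2)[OF j] s] expectation_low_work[OF s] busy[OF j]
    by (simp add: integrable_slot excess_def distrib_left)
qed

text \<open>For \<open>b > 0\<close> the difference of backlogs has drift
  \<open>load j - load b\<close>, nonnegative by the ordering, and the part weighted by
  \<open>\<theta>\<close> gains \<open>\<theta> * excess\<close>; for \<open>b = 0\<close> the gain
  is even \<open>excess\<close>.\<close>

lemma expectation_potential:
  assumes j: "j \<in> {k..N}" and b: "b \<in> {0..<k}" and s: "proper M s"
    and busy: "\<And>j. j \<in> {k..N} \<Longrightarrow> 0 < fst s j" and b_busy: "b = 0 \<or> 0 < fst s b"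
  shows "potential K j b s + \<theta> * excess \<le> measure_pmf.expectation (K_slot s) (potential K j b)"
proof (cases "b = 0")
  case True
  have "\<theta> * excess \<le> excess"
    using \<theta> excess_pos by (simp add: mult_le_cancel_right1)
  then show ?thesis
    using True expectation_potential_0[OF j s busy] by (simp add: potential_def[abs_def])
next
  case False
  then have b': "b \<in> {1..<k}" using b by auto
  let ?E = "measure_pmf.expectation (K_slot s)"
  have "?E (\<lambda>s. backlog j s - backlog b s) = backlog j s - backlog b s + (load j - load b)"
    using expectation_backlog[OF index_range(2)[OF j] s] expectation_backlog[OF index_range(1)[OF b'] s]
      busy[OF j] b_busy False by (simp add: integrable_slot)
  moreover have "load b \<le> load j"
    using load_le[of b j] index_range(1)[OF b'] index_range(2)[OF j] b' j by auto
  ultimately have "(1 - \<theta>) * (backlog j s - backlog b s) \<le>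
      (1 - \<theta>) * ?E (\<lambda>s. backlog j s - backlog b s)"
    using \<theta> by (intro mult_left_mono) auto
  moreover have "\<theta> * (backlog j s + low_work s + excess) \<le> \<theta> * ?E (\<lambda>s. backlog j s + low_work s)"
    using expectation_potential_0[OF j s busy] \<theta> by (intro mult_left_mono) auto
  moreover have "?E (potential K j b) = K + (1 - \<theta>) * ?E (\<lambda>s. backlog j s - backlog b s) +
      \<theta> * ?E (\<lambda>s. backlog j s + low_work s)"
    using False by (simp add: potential_def[abs_def] integrable_slot measure_pmf.prob_space)
  ultimately show ?thesis
    using False by (simp add: potential_def algebra_simps)
qed

text \<open>The second factor bounds the change of any backlog in a slot; the first leaves room for
  two such changes in the difference and \<open>1 + low_odds\<close> in the plain sum.\<close>

definition jump where
  "jump = (4 + low_odds) * (1 + (\<Sum>n\<in>{1..N}. 2 * rem_bound (q n) M / odds n))"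

lemma jump_pos: "0 < jump"
proof -
  have "0 \<le> (\<Sum>n\<in>{1..N}. 2 * rem_bound (q n) M / odds n)"
    using odds_pos q by (intro sum_nonneg divide_nonneg_nonneg)
      (auto simp: rem_bound_def less_imp_le intro!: sum_nonneg rem_nonneg)
  then show ?thesis
    using low_odds_nonneg by (simp add: jump_def add_pos_nonneg)
qed

lemma potential_jump:
  assumes j: "j \<in> {k..N}" and b: "b \<in> {0..<k}" and s: "proper M s"
    and s': "s' \<in> set_pmf (K_slot s)"
  shows "\<bar>potential K j b s' - potential K j b s\<bar> \<le> jump"
proof -
  define B where "B = 1 + (\<Sum>n\<in>{1..N}. 2 * rem_bound (q n) M / odds n)"
  have bound: "0 \<le> 2 * rem_bound (q n) M / odds n" if "n \<in> {1..N}" for n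
    using odds_pos[OF that] q[OF that]
    by (auto simp: rem_bound_def intro!: divide_nonneg_pos mult_nonneg_nonneg sum_nonneg rem_nonneg)
  have B: "\<bar>backlog n s' - backlog n s\<bar> \<le> B" if n: "n \<in> {1..N}" for n
  proof -
    have "\<bar>backlog n s' - backlog n s\<bar> =
        \<bar>workload M (q n) n s' - workload M (q n) n s\<bar> / odds n"
      using odds_pos[OF n] by (simp add: backlog_def diff_divide_distrib[symmetric])
    also have "\<dots> \<le> 2 * rem_bound (q n) M / odds n"
      using workload_jump[where q=q and n=n, of M s s' N lam p] q[OF n] s s' odds_pos[OF n]
      by (intro divide_right_mono) auto
    also have "\<dots> \<le> (\<Sum>n\<in>{1..N}. 2 * rem_bound (q n) M / odds n)"
      using n bound by (intro member_le_sum) auto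
    finally show ?thesis by (simp add: B_def)
  qed
  have low: "\<bar>low_work s' - low_work s\<bar> \<le> low_odds * B"
  proof -
    have "\<bar>low_work s' - low_work s\<bar> = \<bar>\<Sum>i\<in>{1..<k}. odds i * (backlog i s' - backlog i s)\<bar>"
      by (simp add: low_work_def sum_subtractf[symmetric] right_diff_distrib)
    also have "\<dots> \<le> (\<Sum>i\<in>{1..<k}. \<bar>odds i * (backlog i s' - backlog i s)\<bar>)"
      by (rule sum_abs)
    also have "\<dots> \<le> (\<Sum>i\<in>{1..<k}. odds i * B)"
      using B odds_pos index_range by (intro sum_mono) (auto simp: abs_mult less_imp_le intro!: mult_mono)
    finally show ?thesis by (simp add: low_odds_def sum_distrib_right)
  qed
  have B0: "0 \<le> B" using B[of k] k by force
  have sum: "\<bar>(backlog j s' + low_work s') - (backlog j s + low_work s)\<bar> \<le> (1 + low_odds) * B"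
    using B[OF index_range(2)[OF j]] low by (simp add: distrib_right)
  have jump: "jump = (4 + low_odds) * B" by (simp add: jump_def B_def)
  show ?thesis
  proof (cases "b = 0")
    case True
    then show ?thesis using sum B0 by (simp add: potential_def jump distrib_right)
  next
    case False
    then have "b \<in> {1..<k}" using b by auto
    then have "\<bar>(backlog j s' - backlog b s') - (backlog j s - backlog b s)\<bar> \<le> 2 * B"
      using B[OF index_range(2)[OF j]] B[OF index_range(1)] by fastforce
    then have "\<bar>(1 - \<theta>) * ((backlog j s' - backlog b s') - (backlog j s - backlog b s))\<bar> \<le> 1 * (2 * B)"
      unfolding abs_mult using \<theta> by (intro mult_mono) auto
    moreover have "\<bar>\<theta> * ((backlog j s' + low_work s') - (backlog j s + low_work s))\<bar> \<le>
        1 * ((1 + low_odds) * B)"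
      unfolding abs_mult using \<theta> sum by (intro mult_mono) auto
    moreover have "potential K j b s' - potential K j b s =
        (1 - \<theta>) * ((backlog j s' - backlog b s') - (backlog j s - backlog b s)) +
        \<theta> * ((backlog j s' + low_work s') - (backlog j s + low_work s))"
      using False by (simp add: potential_def algebra_simps)
    ultimately show ?thesis
      using B0 by (simp add: jump distrib_right)
  qed
qed

section \<open>Potentials of empty sources\<close>

lemma ex_max_backlog:
  assumes "i \<in> {1..<k}"
  obtains l where "l \<in> {1..<k}" "\<And>i. i \<in> {1..<k} \<Longrightarrow> backlog i s \<le> backlog l s"
proof -
  obtain l where "l \<in> {1..<k}" "Max ((\<lambda>i. backlog i s) ` {1..<k}) = backlog l s"
    using obtains_MAX[of "{1..<k}" "\<lambda>i. backlog i s"] assms by blast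
  then show ?thesis
    using that by (metis Max_ge finite_atLeastLessThan finite_imageI imageI)
qed

text \<open>If \<open>j\<close> is empty, the witness is the fullest source below \<open>k\<close>:
  by the choice of \<open>\<theta>\<close>, its negative contribution outweighs that of
  \<open>low_work\<close>. For \<open>k = 1\<close> the plain sum is \<open>0\<close>.\<close>

lemma potential_le_if_empty:
  assumes K: "0 \<le> K" and j: "j \<in> {k..N}" and s: "proper M s" and empty: "fst s j = 0"
  shows "\<exists>b\<in>{0..<k}. potential K j b s \<le> K"
proof (cases "k = 1")
  case True
  then have "low_work s = 0" unfolding low_work_def by simp
  then have "potential K j 0 s \<le> K"
    using backlog_empty[OF s empty] K by (simp add: potential_def)
  then show ?thesis using k by force
next
  case False
  then have "1 \<in> {1..<k}" using k by auto
  then obtain l where l: "l \<in> {1..<k}" "\<And>i. i \<in> {1..<k} \<Longrightarrow> backlog i s \<le> backlog l s"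
    using ex_max_backlog by blast
  have "0 \<le> backlog l s" using backlog_nonneg[OF index_range(1)[OF l(1)] s] .
  have "\<theta> * low_work s \<le> \<theta> * (low_odds * backlog l s)"
    using \<theta> low_work_le[OF l(2)] by (intro mult_left_mono) auto
  then have "- (1 - \<theta>) * backlog l s + \<theta> * low_work s \<le>
      (\<theta> * (1 + low_odds) - 1) * backlog l s"
    by (simp add: algebra_simps)
  also have "\<dots> \<le> 0"
    unfolding \<theta>(3) using \<open>0 \<le> backlog l s\<close> by simp
  finally have "potential K j l s \<le> K"
    using l(1) backlog_empty[OF s empty] by (simp add: potential_def algebra_simps)
  then show ?thesis using l by auto
qed

text \<open>This is why the potentials with \<open>b > 0\<close> carry the offset \<open>K\<close>.
  For empty \<open>b\<close>, either \<open>low_work s \<le> K / 2\<close> and the plain sum is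
  smaller, or the fullest source below \<open>k\<close> has a backlog of order \<open>K\<close> and
  its potential is smaller.\<close>

lemma potential_dominated:
  assumes K: "0 \<le> K" and b: "b \<in> {1..<k}" and s: "proper M s" and empty: "fst s b = 0"
  shows "\<exists>b'\<in>{0..<k}. potential K j b' s + K / (4 * (1 + low_odds)) \<le> potential K j b s"
proof -
  have C: "0 < 1 + low_odds" using low_odds_nonneg by simp
  have xb: "backlog b s = 0" using backlog_empty[OF s empty] .
  have "b \<noteq> 0" using b by simp
  show ?thesis
  proof (cases "low_work s \<le> K / 2")
    case True
    have "(1 - \<theta>) * low_work s \<le> 1 * (K / 2)"
      using True \<theta> low_work_nonneg[OF s] K by (intro mult_mono) auto
    moreover have "K / (4 * (1 + low_odds)) \<le> K / 2"
      using K low_odds_nonneg by (intro divide_left_mono) auto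
    moreover have "potential K j b s - potential K j 0 s = K - (1 - \<theta>) * low_work s"
      using xb \<open>b \<noteq> 0\<close> by (simp add: potential_def algebra_simps)
    ultimately have "potential K j 0 s + K / (4 * (1 + low_odds)) \<le> potential K j b s"
      by linarith
    then show ?thesis using k by force
  next
    case False
    obtain l where l: "l \<in> {1..<k}" "\<And>i. i \<in> {1..<k} \<Longrightarrow> backlog i s \<le> backlog l s"
      using ex_max_backlog[OF b] by blast
    have xl: "0 \<le> backlog l s" using backlog_nonneg[OF index_range(1)[OF l(1)] s] .
    have "K / 2 \<le> (1 + low_odds) * backlog l s"
      using False low_work_le[OF l(2)] xl by (simp add: distrib_right)
    then have "K / (4 * (1 + low_odds)) \<le> 1 / 2 * backlog l s"
      using C by (simp add: field_simps)
    also have "\<dots> \<le> (1 - \<theta>) * backlog l s"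
      using \<theta> xl by (intro mult_right_mono) auto
    finally have "potential K j l s + K / (4 * (1 + low_odds)) \<le> potential K j b s"
      using xb \<open>b \<noteq> 0\<close> l(1) by (simp add: potential_def algebra_simps)
    then show ?thesis using l(1) by force
  qed
qed

section \<open>Contraction of the Lyapunov function\<close>

lemma lyapunov_nonneg: "0 \<le> lyapunov \<delta> K s"
  unfolding lyapunov_def by (intro sum_nonneg) auto

lemma exp_potential_le_lyapunov:
  assumes "j \<in> {k..N}" "b \<in> {0..<k}"
  shows "exp (- \<delta> * potential K j b s) \<le> lyapunov \<delta> K s"
proof -
  have "exp (- \<delta> * potential K j b s) \<le> (\<Sum>b\<in>{0..<k}. exp (- \<delta> * potential K j b s))"
    using assms by (intro member_le_sum) auto
  also have "\<dots> \<le> lyapunov \<delta> K s"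
    unfolding lyapunov_def using assms
    by (intro member_le_sum[of j _ "\<lambda>j. \<Sum>b\<in>{0..<k}. exp (- \<delta> * potential K j b s)"])
       (auto intro!: sum_nonneg)
  finally show ?thesis .
qed

text \<open>The threshold is the size of a term whose potential is \<open>K\<close>, and an empty
  \<open>j\<close> would supply a term at least this large.\<close>

lemma lyapunov_busy:
  assumes "0 \<le> K" "0 \<le> \<delta>" "proper M s" "lyapunov \<delta> K s < exp (- \<delta> * K)" "j \<in> {k..N}"
  shows "0 < fst s j"
proof (rule ccontr)
  assume "\<not> 0 < fst s j"
  then obtain b where b: "b \<in> {0..<k}" "potential K j b s \<le> K"
    using potential_le_if_empty[of K j s] assms by auto
  have "exp (- \<delta> * K) \<le> exp (- \<delta> * potential K j b s)"
    using b assms by (simp add: mult_left_mono)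
  with exp_potential_le_lyapunov[OF assms(5) b(1), of \<delta> K s] assms(4) show False by linarith
qed

text \<open>The terms of an empty source \<open>b\<close> may grow, but for large \<open>K\<close> they are negligible
  compared with another term of the same \<open>j\<close>.\<close>

lemma lyapunov_drift:
  obtains \<delta> K \<eta> where "0 < \<delta>" "0 \<le> K" "0 < \<eta>"
    "\<And>s. proper M s \<Longrightarrow> lyapunov \<delta> K s < exp (- \<delta> * K) \<Longrightarrow>
       measure_pmf.expectation (K_slot s) (lyapunov \<delta> K) \<le> (1 - \<eta>) * lyapunov \<delta> K s"
proof -
  define d where "d = \<theta> * excess"
  have d: "0 < d" using \<theta> excess_pos by (simp add: d_def)
  \<comment> \<open>The three bounds keep the exponents within the range of
    \<open>exp_le_quadratic\<close>, make the quadratic loss at most half of the gain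
    \<open>\<delta> * d\<close>, and give \<open>\<rho> \<le> 1\<close>.\<close>
  define \<delta> where "\<delta> = min (1 / jump) (min (d / (2 * jump\<^sup>2)) (1 / d))"
  define \<rho> where "\<rho> = \<delta> * d / 2"
  have \<delta>: "0 < \<delta>" "\<delta> \<le> 1 / jump" "\<delta> \<le> d / (2 * jump\<^sup>2)" "\<delta> \<le> 1 / d"
    using jump_pos d unfolding \<delta>_def by auto
  then have \<delta>': "\<delta> * jump \<le> 1" "\<delta> * (2 * jump\<^sup>2) \<le> d" "\<delta> * d \<le> 1"
    using jump_pos d by (auto simp: pos_le_divide_eq)
  have \<rho>: "0 < \<rho>" "\<rho> \<le> 1" using \<delta> \<delta>' d by (auto simp: \<rho>_def)
  have quad: "(\<delta> * jump)\<^sup>2 \<le> \<rho>"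
    using mult_left_mono[OF \<delta>'(2), of \<delta>] \<delta> by (simp add: \<rho>_def power2_eq_square algebra_simps)
  \<comment> \<open>\<open>K\<close> has to beat \<open>k\<close> terms, each adding at most
    \<open>3 * \<kappa>\<close> times the inner sum; the factor \<open>3\<close> bounds
    \<open>exp 1\<close>.\<close>
  obtain m :: nat where m: "3 * real k * exp (- (\<delta> / (4 * (1 + low_odds)) * real m)) < \<rho> / 2"
    using ex_nat_times_exp_less[of "\<delta> / (4 * (1 + low_odds))" "\<rho> / 2" "3 * real k"] \<rho> \<delta>
      low_odds_nonneg by auto
  define K where "K = real m"
  define \<kappa> where "\<kappa> = exp (- (\<delta> / (4 * (1 + low_odds)) * K))"
  have K: "0 \<le> K" by (simp add: K_def)
  have \<kappa>: "3 * real k * \<kappa> \<le> \<rho> / 2" "0 \<le> \<kappa>" using m by (auto simp: \<kappa>_def K_def)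
  have main: "measure_pmf.expectation (K_slot s) (lyapunov \<delta> K) \<le> (1 - \<rho> / 2) * lyapunov \<delta> K s"
    if s: "proper M s" and small: "lyapunov \<delta> K s < exp (- \<delta> * K)" for s
  proof -
    let ?E = "measure_pmf.expectation (K_slot s)"
    let ?e = "\<lambda>j b s. exp (- \<delta> * potential K j b s)"
    have busy: "0 < fst s j" if "j \<in> {k..N}" for j
      using lyapunov_busy[OF K _ s small that] \<delta> by simp
    have step: "?E (?e j b) \<le> (1 - \<rho>) * ?e j b s + 3 * \<kappa> * (\<Sum>b\<in>{0..<k}. ?e j b s)"
      if j: "j \<in> {k..N}" and b: "b \<in> {0..<k}" for j b
    proof (cases "b = 0 \<or> 0 < fst s b")
      case True
      have "?E (?e j b) \<le> (1 - \<delta> * d + (\<delta> * jump)\<^sup>2) * ?e j b s"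
        using expectation_potential[OF j b s busy True, of K] potential_jump[OF j b s] \<delta> \<delta>'
        by (intro expectation_exp_drift finite_set_slot) (auto simp: d_def)
      also have "\<dots> \<le> (1 - \<rho>) * ?e j b s"
        using quad by (intro mult_right_mono) (auto simp: \<rho>_def)
      also have "\<dots> \<le> (1 - \<rho>) * ?e j b s + 3 * \<kappa> * (\<Sum>b\<in>{0..<k}. ?e j b s)"
        using \<kappa> by (auto intro!: mult_nonneg_nonneg sum_nonneg)
      finally show ?thesis .
    next
      case False
      then obtain b' where b': "b' \<in> {0..<k}"
        "potential K j b' s + K / (4 * (1 + low_odds)) \<le> potential K j b s"
        using potential_dominated[OF K _ s, of b j] b by auto
      have "?e j b s \<le> exp (- \<delta> * (potential K j b' s + K / (4 * (1 + low_odds))))"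
        using b'(2) \<delta> by (simp add: mult_left_mono)
      also have "\<dots> = \<kappa> * ?e j b' s"
        by (simp add: \<kappa>_def exp_add[symmetric] algebra_simps)
      also have "\<dots> \<le> \<kappa> * (\<Sum>b\<in>{0..<k}. ?e j b s)"
        using b'(1) \<kappa> by (intro mult_left_mono member_le_sum) auto
      finally have dom: "?e j b s \<le> \<kappa> * (\<Sum>b\<in>{0..<k}. ?e j b s)" .
      have "?E (?e j b) \<le> ?E (\<lambda>s'. 3 * ?e j b s)"
      proof (intro integral_mono_AE integrable_slot AE_pmfI)
        fix s' assume "s' \<in> set_pmf (K_slot s)"
        then have "\<delta> * (potential K j b s - potential K j b s') \<le> \<delta> * jump"
          using potential_jump[OF j b s, of s' K] \<delta> by (intro mult_left_mono) auto
        then have "- \<delta> * potential K j b s' \<le> 1 + - \<delta> * potential K j b s"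
          using \<delta>'(1) by (simp add: algebra_simps)
        then have "?e j b s' \<le> exp (1 + - \<delta> * potential K j b s)"
          by (simp only: exp_le_cancel_iff)
        also have "\<dots> \<le> 3 * ?e j b s"
          unfolding exp_add using exp_le by (intro mult_right_mono) auto
        finally show "?e j b s' \<le> 3 * ?e j b s" .
      qed
      also have "\<dots> = 3 * ?e j b s" by (simp add: measure_pmf.prob_space)
      also have "\<dots> \<le> 3 * (\<kappa> * (\<Sum>b\<in>{0..<k}. ?e j b s))"
        using dom by (intro mult_left_mono) auto
      also have "\<dots> \<le> (1 - \<rho>) * ?e j b s + 3 * \<kappa> * (\<Sum>b\<in>{0..<k}. ?e j b s)"
        using \<rho> by (simp add: mult.assoc)
      finally show ?thesis .
    qed
    have "?E (lyapunov \<delta> K) = (\<Sum>j\<in>{k..N}. \<Sum>b\<in>{0..<k}. ?E (?e j b))"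
      unfolding lyapunov_def[abs_def] by (simp add: integrable_slot)
    also have "\<dots> \<le> (\<Sum>j\<in>{k..N}. (1 - \<rho> / 2) * (\<Sum>b\<in>{0..<k}. ?e j b s))"
    proof (rule sum_mono)
      fix j assume j: "j \<in> {k..N}"
      let ?S = "\<Sum>b\<in>{0..<k}. ?e j b s"
      have "(\<Sum>b\<in>{0..<k}. ?E (?e j b)) \<le>
          (\<Sum>b\<in>{0..<k}. (1 - \<rho>) * ?e j b s + 3 * \<kappa> * ?S)"
        by (intro sum_mono step j)
      also have "\<dots> = (1 - \<rho>) * ?S + 3 * real k * \<kappa> * ?S"
        by (simp add: sum.distrib sum_distrib_left mult_ac)
      also have "\<dots> \<le> (1 - \<rho>) * ?S + \<rho> / 2 * ?S"
        using \<kappa> by (intro add_left_mono mult_right_mono sum_nonneg) auto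
      also have "\<dots> = (1 - \<rho> / 2) * ?S" by (simp add: algebra_simps)
      finally show "(\<Sum>b\<in>{0..<k}. ?E (?e j b)) \<le> (1 - \<rho> / 2) * ?S" .
    qed
    also have "\<dots> = (1 - \<rho> / 2) * lyapunov \<delta> K s"
      by (simp add: lyapunov_def sum_distrib_left)
    finally show ?thesis .
  qed
  show ?thesis
    by (rule that[of \<delta> K "\<rho> / 2"]) (use \<delta> K \<rho> main in auto)
qed

section \<open>Reaching the contracting region\<close>

text \<open>Letting only the sources \<open>j \<ge> k\<close> have arrivals would make all potentials grow, but a source
  with arrival rate \<open>1\<close> cannot be prevented from receiving packets.\<close>

definition active where "active n \<longleftrightarrow> n \<in> {1..N} \<and> (k \<le> n \<or> lam n = 1)"

text \<open>The state after \<open>m\<close> slots in which nobody transmits and exactly the active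
  sources receive a packet.\<close>

definition pile_up :: "nat \<Rightarrow> state \<Rightarrow> state" where
  "pile_up m s = ((\<lambda>n. fst s n + m * of_bool (active n)), snd s)"

lemma pile_up_Suc: "pile_up (Suc m) s = pile_up 1 (pile_up m s)"
  by (simp add: pile_up_def fun_eq_iff)

lemma pile_up_0: "pile_up 0 s = s"
  by (simp add: pile_up_def)

lemma proper_pile_up: "proper M s \<Longrightarrow> proper M (pile_up m s)"
  by (auto simp: proper_def pile_up_def)

definition pile_up_prob where
  "pile_up_prob = pmf (arrivals N lam) active * (\<Prod>j\<in>{1..N}. 1 - p j)"

lemma pile_up_prob_pos: "0 < pile_up_prob"
proof -
  have "0 < pmf (bernoulli_pmf (lam n)) (active n)" if n: "n \<in> {1..N}" for n
  proof (cases "active n")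
    case True
    then show ?thesis
      using lam[OF n] lam_pos[of n] n by (auto simp: active_def)
  next
    case False
    then show ?thesis
      using lam[OF n] n by (auto simp: active_def)
  qed
  then have "0 < pmf (arrivals N lam) active"
    unfolding arrivals_def by (subst pmf_Pi') (auto simp: active_def intro!: prod_pos)
  moreover have "0 < (\<Prod>j\<in>{1..N}. 1 - p j)"
    using p by (intro prod_pos) auto
  ultimately show ?thesis by (simp add: pile_up_prob_def)
qed

lemma pile_up_prob_le:
  assumes s: "proper M s"
  shows "pile_up_prob \<le> pmf (K_slot s) (pile_up 1 s)"
proof -
  have "\<not> completes M s (\<lambda>_. False) n" "received M (snd s) (\<lambda>_. False) n = snd s n" for n
    using s by (auto simp: proper_def completes_def received_def)
  then have next_state: "next_state M s active (\<lambda>_. False) = pile_up 1 s"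
    by (simp add: next_state_def pile_up_def)
  have "(\<lambda>(n, d). if sole_transmitter N (\<lambda>_. False) n then bernoulli_pmf (q n) else return_pmf False) =
      (\<lambda>_ :: nat \<times> nat. return_pmf False)"
    by (auto simp: sole_transmitter_def)
  then have "receptions N M q (\<lambda>_. False) = return_pmf (\<lambda>_. False)"
    by (simp add: receptions_def)
  then have silent: "bind_pmf (receptions N M q (\<lambda>_. False)) (\<lambda>R. return_pmf (next_state M s active R)) =
      return_pmf (pile_up 1 s)"
    by (simp add: bind_return_pmf next_state)
  have "(\<Prod>j\<in>{1..N}. 1 - p j) \<le> silence N p (fst s)"
    unfolding silence_def using p by (intro prod_mono) (auto simp: less_imp_le)
  also have "\<dots> = pmf (transmissions N p (fst s)) (\<lambda>_. False)"
    using p by (rule pmf_transmissions_silent[symmetric])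
  finally have "pile_up_prob \<le> pmf (arrivals N lam) active *
      (pmf (transmissions N p (fst s)) (\<lambda>_. False) * pmf (return_pmf (pile_up 1 s)) (pile_up 1 s))"
    unfolding pile_up_prob_def by (simp add: mult_left_mono)
  also have "\<dots> \<le> pmf (arrivals N lam) active * pmf (bind_pmf (transmissions N p (fst s)) (\<lambda>T.
      bind_pmf (receptions N M q T) (\<lambda>R. return_pmf (next_state M s active R)))) (pile_up 1 s)"
    unfolding silent[symmetric] by (intro mult_left_mono pmf_bind_ge) auto
  also have "\<dots> \<le> pmf (K_slot s) (pile_up 1 s)"
    unfolding slot_def by (rule pmf_bind_ge)
  finally show ?thesis .
qed

lemma backlog_pile_up:
  "backlog n (pile_up m s) = backlog n s + real m * of_bool (active n) * (rem (q n) M / odds n)"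
  by (simp add: backlog_def workload_def pile_up_def add_divide_distrib[symmetric] algebra_simps)

text \<open>Piling up raises \<open>backlog j\<close> at least as much as \<open>backlog b\<close>
  and never lowers \<open>low_work\<close>, so the part weighted by \<open>\<theta>\<close>
  guarantees the growth.\<close>

lemma potential_pile_up:
  assumes j: "j \<in> {k..N}" and b: "b \<in> {0..<k}"
  shows "potential K j b s + real m * (\<theta> * (rem (q j) M / odds j)) \<le> potential K j b (pile_up m s)"
proof -
  let ?G = "\<lambda>n. rem (q n) M / odds n"
  have G: "0 < ?G n" if "n \<in> {1..N}" for n
    using that rem_pos' odds_pos by auto
  have Gj: "0 < ?G j" using G index_range(2)[OF j] .
  have active_j: "active j" using j k by (auto simp: active_def)
  have low: "low_work s \<le> low_work (pile_up m s)"
    unfolding low_work_def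
  proof (intro sum_mono mult_left_mono)
    fix i assume i: "i \<in> {1..<k}"
    have "0 \<le> real m * of_bool (active i) * ?G i"
      using G[OF index_range(1)[OF i]] by (intro mult_nonneg_nonneg) (auto simp: less_imp_le)
    then show "backlog i s \<le> backlog i (pile_up m s)" by (simp add: backlog_pile_up)
    show "0 \<le> odds i" using odds_pos[OF index_range(1)[OF i]] by simp
  qed
  show ?thesis
  proof (cases "b = 0")
    case True
    have "real m * (\<theta> * ?G j) \<le> real m * (1 * ?G j)"
      using \<theta> Gj by (intro mult_left_mono mult_right_mono) auto
    then show ?thesis
      using True low active_j by (simp add: potential_def backlog_pile_up)
  next
    case False
    then have b': "b \<in> {1..<k}" using b by auto
    have "of_bool (active b) * ?G b \<le> ?G j"
    proof (cases "active b")
      case True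
      \<comment> \<open>With arrival rate \<open>1\<close>, \<open>rem (q b) M / odds b\<close>
        equals \<open>load b\<close>, and the ordering of the loads applies.\<close>
      then have "lam b = 1" using b' by (auto simp: active_def)
      then have "?G b \<le> lam j * ?G j"
        using load_le[of b j] index_range(1)[OF b'] index_range(2)[OF j] b' j by (auto simp: load_def)
      also have "\<dots> \<le> 1 * ?G j"
        using lam[OF index_range(2)[OF j]] Gj by (intro mult_right_mono) auto
      finally show ?thesis using True by simp
    qed (use Gj in simp)
    then have "0 \<le> (1 - \<theta>) * (real m * (?G j - of_bool (active b) * ?G b))"
      using \<theta> by (intro mult_nonneg_nonneg) auto
    moreover have "\<theta> * low_work s \<le> \<theta> * low_work (pile_up m s)"
      using low \<theta> by (intro mult_left_mono) auto
    moreover have "potential K j b (pile_up m s) - potential K j b s =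
        (1 - \<theta>) * (real m * (?G j - of_bool (active b) * ?G b)) + real m * (\<theta> * ?G j) +
        (\<theta> * low_work (pile_up m s) - \<theta> * low_work s)"
      using False active_j by (simp only: potential_def backlog_pile_up if_False) (simp add: algebra_simps)
    ultimately show ?thesis by linarith
  qed
qed

lemma ex_backlog_bound:
  "\<exists>Y. \<forall>n\<in>{1..N}. \<forall>s. proper M s \<longrightarrow> fst s n < X \<longrightarrow> backlog n s \<le> Y"
proof -
  let ?Y = "\<lambda>n. (real X * rem (q n) M + rem_bound (q n) M) / odds n"
  have le: "backlog n s \<le> ?Y n" if n: "n \<in> {1..N}" and s: "proper M s" "fst s n < X" for n s
  proof -
    note q = q[OF n, THEN conjunct1] q[OF n, THEN conjunct2]
    have "real (fst s n) * rem (q n) M \<le> real X * rem (q n) M"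
      using s(2) rem_nonneg[OF q, of M] by (intro mult_right_mono) auto
    moreover have "rem (q n) (M - card (snd s n)) \<le> rem_bound (q n) M" "0 \<le> rem (q n) M"
      using rem_le_bound[OF q] rem_nonneg[OF q] by auto
    ultimately have "workload M (q n) n s \<le> real X * rem (q n) M + rem_bound (q n) M"
      unfolding workload_def by linarith
    then show ?thesis
      unfolding backlog_def using odds_pos[OF n] by (intro divide_right_mono) auto
  qed
  show ?thesis
  proof (intro exI ballI allI impI)
    fix n s assume n: "n \<in> {1..N}" and s: "proper M s" "fst s n < X"
    have "backlog n s \<le> Max (?Y ` {1..N})"
      using le[OF n s] Max_ge[of "?Y ` {1..N}" "?Y n"] n by (meson finite_atLeastAtMost finite_imageI imageI order_trans)
    then show "backlog n s \<le> Max (?Y ` {1..N})" .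
  qed
qed

text \<open>Bounded queues bound all potentials from below, and piling up raises them at a uniform
  rate, so one \<open>m\<close> serves all such states.\<close>

lemma lyapunov_pile_up_small:
  assumes \<delta>: "0 < \<delta>" and K: "0 \<le> K" and u: "0 < u"
  obtains m where "\<And>s. proper M s \<Longrightarrow> (\<forall>n\<in>{1..N}. fst s n < X) \<Longrightarrow> lyapunov \<delta> K (pile_up m s) < u"
proof -
  obtain Y where Y: "\<And>n s. n \<in> {1..N} \<Longrightarrow> proper M s \<Longrightarrow> fst s n < X \<Longrightarrow> backlog n s \<le> Y"
    using ex_backlog_bound by blast
  define \<tau> where "\<tau> = \<theta> * Min ((\<lambda>j. rem (q j) M / odds j) ` {k..N})"
  have ne: "{k..N} \<noteq> {}" using k by auto
  then have "Min ((\<lambda>j. rem (q j) M / odds j) ` {k..N}) \<in> (\<lambda>j. rem (q j) M / odds j) ` {k..N}"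
    by (intro Min_in) auto
  then have \<tau>: "0 < \<tau>"
    using \<theta> rem_pos' odds_pos index_range(2) by (auto simp: \<tau>_def)
  have \<tau>_le: "\<tau> \<le> \<theta> * (rem (q j) M / odds j)" if "j \<in> {k..N}" for j
    unfolding \<tau>_def using that \<theta> by (intro mult_left_mono Min_le) auto
  let ?c = "real (card {k..N}) * real k * exp (\<delta> * \<bar>Y\<bar>)"
  obtain m :: nat where m: "?c * exp (- (\<delta> * \<tau> * real m)) < u"
    using ex_nat_times_exp_less[of "\<delta> * \<tau>" u ?c] \<delta> \<tau> u by auto
  have "lyapunov \<delta> K (pile_up m s) < u" if s: "proper M s" and X: "\<forall>n\<in>{1..N}. fst s n < X" for s
  proof -
    have "real m * \<tau> - \<bar>Y\<bar> \<le> potential K j b (pile_up m s)" if j: "j \<in> {k..N}" and b: "b \<in> {0..<k}" for j b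
    proof -
      have "- \<bar>Y\<bar> \<le> potential K j b s"
      proof (cases "b = 0")
        case True
        then show ?thesis
          using backlog_nonneg[OF index_range(2)[OF j] s] low_work_nonneg[OF s] by (simp add: potential_def)
      next
        case False
        then have b': "b \<in> {1..N}" using b k by auto
        have "(1 - \<theta>) * (- \<bar>Y\<bar>) \<le> (1 - \<theta>) * (backlog j s - backlog b s)"
          using Y[OF b' s] X b' backlog_nonneg[OF index_range(2)[OF j] s] \<theta> by (intro mult_left_mono) auto
        moreover have "1 * (- \<bar>Y\<bar>) \<le> (1 - \<theta>) * (- \<bar>Y\<bar>)"
          using \<theta> by (intro mult_right_mono_neg) auto
        moreover have "0 \<le> \<theta> * (backlog j s + low_work s)"
          using backlog_nonneg[OF index_range(2)[OF j] s] low_work_nonneg[OF s] \<theta>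
          by (intro mult_nonneg_nonneg) auto
        ultimately show ?thesis
          using False K by (simp add: potential_def)
      qed
      moreover have "real m * \<tau> \<le> real m * (\<theta> * (rem (q j) M / odds j))"
        using \<tau>_le[OF j] by (intro mult_left_mono) auto
      ultimately show ?thesis
        using potential_pile_up[OF j b, of K s m] by linarith
    qed
    then have "lyapunov \<delta> K (pile_up m s) \<le> (\<Sum>j\<in>{k..N}. \<Sum>b\<in>{0..<k}. exp (- \<delta> * (real m * \<tau> - \<bar>Y\<bar>)))"
      unfolding lyapunov_def using \<delta> by (intro sum_mono) (simp add: mult_left_mono)
    also have "\<dots> = ?c * exp (- (\<delta> * \<tau> * real m))"
      by (simp add: exp_add[symmetric] algebra_simps)
    finally show ?thesis using m by simp
  qed
  then show ?thesis using that by blast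
qed

text \<open>The queues stay below \<open>X + m\<close>, so already the term \<open>j = k\<close>,
  \<open>b = 0\<close> is bounded away from \<open>0\<close>.\<close>

lemma lyapunov_pile_up_bounded_below:
  assumes \<delta>: "0 < \<delta>"
  obtains u where "0 < u"
    "\<And>s. proper M s \<Longrightarrow> (\<forall>n\<in>{1..N}. fst s n < X) \<Longrightarrow> u \<le> lyapunov \<delta> K (pile_up m s)"
proof -
  obtain Y where Y: "\<And>n s. n \<in> {1..N} \<Longrightarrow> proper M s \<Longrightarrow> fst s n < X + m \<Longrightarrow> backlog n s \<le> Y"
    using ex_backlog_bound by blast
  show ?thesis
  proof (rule that[of "exp (- \<delta> * (Y + low_odds * Y))"])
    fix s assume s: "proper M s" and X: "\<forall>n\<in>{1..N}. fst s n < X"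
    have bound: "backlog n (pile_up m s) \<le> Y" if "n \<in> {1..N}" for n
    proof -
      have "fst (pile_up m s) n < X + m"
        using X[rule_format, OF that] by (simp add: pile_up_def of_bool_def)
      then show ?thesis
        by (rule Y[OF that proper_pile_up[OF s]])
    qed
    have "potential K k 0 (pile_up m s) \<le> Y + low_odds * Y"
      using bound[OF k] low_work_le[OF bound[OF index_range(1)]] by (simp add: potential_def)
    then have "exp (- \<delta> * (Y + low_odds * Y)) \<le> exp (- \<delta> * potential K k 0 (pile_up m s))"
      using \<delta> by simp
    also have "\<dots> \<le> lyapunov \<delta> K (pile_up m s)"
      using k by (intro exp_potential_le_lyapunov) auto
    finally show "exp (- \<delta> * (Y + low_odds * Y)) \<le> lyapunov \<delta> K (pile_up m s)" .
  qed simp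
qed

lemma prob_pile_up:
  fixes X defines "E \<equiv> {s. proper M s \<and> (\<forall>n\<in>{1..N}. fst s n < X)}"
  shows "pile_up_prob ^ m * measure_pmf.prob (state_dist N M lam p q init t) E \<le>
           measure_pmf.prob (state_dist N M lam p q init (t + m)) (pile_up m ` E)"
proof (induction m)
  case 0
  then show ?case by (simp add: pile_up_0)
next
  case (Suc m)
  let ?D = "state_dist N M lam p q init"
  have step: "pile_up_prob \<le> measure_pmf.prob (K_slot s) (pile_up (Suc m) ` E)"
    if s: "s \<in> pile_up m ` E" for s
  proof -
    obtain s0 where s0: "s0 \<in> E" "s = pile_up m s0"
      using s by blast
    then have "proper M s"
      using proper_pile_up by (simp add: E_def)
    moreover have "pile_up 1 s \<in> pile_up (Suc m) ` E"
      unfolding s0(2) pile_up_Suc[symmetric] using s0(1) by (rule imageI)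
    ultimately have "pmf (K_slot s) (pile_up 1 s) \<le> measure_pmf.prob (K_slot s) (pile_up (Suc m) ` E)"
      unfolding measure_pmf_single[symmetric] by (intro measure_pmf.finite_measure_mono) auto
    with pile_up_prob_le[OF \<open>proper M s\<close>] show ?thesis by (rule order_trans)
  qed
  have "pile_up_prob * (pile_up_prob ^ m * measure_pmf.prob (?D t) E) \<le>
      pile_up_prob * measure_pmf.prob (?D (t + m)) (pile_up m ` E)"
    using Suc pile_up_prob_pos by (intro mult_left_mono) auto
  also have "\<dots> \<le> measure_pmf.prob (?D (t + Suc m)) (pile_up (Suc m) ` E)"
    unfolding add_Suc_right state_dist.simps
    using pile_up_prob_pos by (intro prob_bind_pmf_ge step) auto
  finally show ?case by (simp add: mult.assoc)
qed

section \<open>Instability under overload\<close>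

lemma not_stable: "\<not> system_stable N M lam p q init"
proof
  assume "system_stable N M lam p q init"
  let ?D = "state_dist N M lam p q init"
  obtain F :: "(nat \<Rightarrow> nat) \<Rightarrow> real" where
    F: "\<And>x. (\<lambda>t. measure_pmf.prob (?D t) {s. \<forall>n\<in>{1..N}. fst s n < x n}) \<longlonglongrightarrow> F x"
    and F1: "(F \<longlongrightarrow> 1) (all_to_infinity N)"
    using \<open>system_stable N M lam p q init\<close> by (auto simp: system_stable_def)
  \<comment> \<open>Along constant vectors every component tends to infinity, so the limit in the
    definition of stability can be taken over a single number \<open>X\<close>.\<close>
  have "filterlim (\<lambda>X _. X) (all_to_infinity N) at_top"
    by (auto simp: all_to_infinity_def filterlim_INF filterlim_filtercomap_iff o_def filterlim_ident)
  then have "((\<lambda>X. F (\<lambda>_. X)) \<longlongrightarrow> 1) at_top"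
    using filterlim_compose[OF F1] by blast
  then have "\<forall>\<^sub>F X in at_top. 1 / 2 < F (\<lambda>_. X)"
    by (rule order_tendstoD) simp
  then obtain X where "1 / 2 < F (\<lambda>_. X)"
    by (auto simp: eventually_at_top_linorder)
  define E where "E = {s. proper M s \<and> (\<forall>n\<in>{1..N}. fst s n < X)}"
  have "measure_pmf.prob (?D t) {s. \<forall>n\<in>{1..N}. fst s n < X} = measure_pmf.prob (?D t) E" for t
    by (intro measure_pmf.finite_measure_eq_AE AE_pmfI)
       (auto simp: E_def proper_state_dist[OF M])
  then have "(\<lambda>t. measure_pmf.prob (?D t) E) \<longlonglongrightarrow> F (\<lambda>_. X)"
    using F[of "\<lambda>_. X"] by simp
  then have tight: "\<forall>\<^sub>F t in sequentially. 1 / 2 < measure_pmf.prob (?D t) E"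
    by (rule order_tendstoD) fact

  obtain \<delta> K \<eta> where \<delta>: "0 < \<delta>" and K: "0 \<le> K" and \<eta>: "0 < \<eta>" and
    drift: "\<And>s. proper M s \<Longrightarrow> lyapunov \<delta> K s < exp (- \<delta> * K) \<Longrightarrow>
      measure_pmf.expectation (K_slot s) (lyapunov \<delta> K) \<le> (1 - \<eta>) * lyapunov \<delta> K s"
    using lyapunov_drift by blast
  have expectation_indicator: "measure_pmf.expectation D (\<lambda>s. c * indicator B s) = c * measure_pmf.prob D B"
    for D :: "state pmf" and c B by simp
  define g where "g s = (if lyapunov \<delta> K s < exp (- \<delta> * K) then lyapunov \<delta> K s else 0)" for s
  have lim: "(\<lambda>t. measure_pmf.expectation (?D t) g) \<longlonglongrightarrow> 0"
    unfolding g_def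
    by (rule truncated_supermartingale_tendsto_0[where K=K_slot and \<eta>=\<eta>])
       (auto simp: lyapunov_nonneg \<eta> finite_set_slot drift proper_state_dist[OF M])
  obtain m where "\<And>s. proper M s \<Longrightarrow> \<forall>n\<in>{1..N}. fst s n < X \<Longrightarrow>
      lyapunov \<delta> K (pile_up m s) < exp (- \<delta> * K)"
    using lyapunov_pile_up_small[OF \<delta> K exp_gt_zero] by blast
  then have m: "\<And>s. s \<in> E \<Longrightarrow> lyapunov \<delta> K (pile_up m s) < exp (- \<delta> * K)"
    unfolding E_def by blast
  obtain u where u: "0 < u" and "\<And>s. proper M s \<Longrightarrow> \<forall>n\<in>{1..N}. fst s n < X \<Longrightarrow>
      u \<le> lyapunov \<delta> K (pile_up m s)"
    using lyapunov_pile_up_bounded_below[OF \<delta>] by blast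
  then have u_le: "\<And>s. s \<in> E \<Longrightarrow> u \<le> lyapunov \<delta> K (pile_up m s)"
    unfolding E_def by blast
  let ?c = "u * (pile_up_prob ^ m * (1 / 2))"
  have "0 < ?c" using u pile_up_prob_pos by simp
  \<comment> \<open>At every late time the queues are below \<open>X\<close> with probability above
    \<open>1 / 2\<close>; \<open>m\<close> slots later the expectation of \<open>g\<close> is then
    at least \<open>?c\<close>, against its limit \<open>0\<close>.\<close>
  have "\<forall>\<^sub>F t in sequentially. ?c \<le> measure_pmf.expectation (?D (t + m)) g"
    using tight
  proof eventually_elim
    case (elim t)
    have "?c \<le> u * (pile_up_prob ^ m * measure_pmf.prob (?D t) E)"
      using elim u pile_up_prob_pos by (intro mult_left_mono) auto
    also have "\<dots> \<le> u * measure_pmf.prob (?D (t + m)) (pile_up m ` E)"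
      using prob_pile_up[of m init t X] u by (intro mult_left_mono) (auto simp: E_def)
    also have "\<dots> = measure_pmf.expectation (?D (t + m)) (\<lambda>s. u * indicator (pile_up m ` E) s)"
      by (rule expectation_indicator[symmetric])
    also have "\<dots> \<le> measure_pmf.expectation (?D (t + m)) g"
    proof (intro integral_mono)
      show "integrable (?D (t + m)) g"
        by (rule measure_pmf.integrable_const_bound[where B="exp (- \<delta> * K)"])
           (auto simp: g_def lyapunov_nonneg less_imp_le)
      show "u * indicator (pile_up m ` E) s \<le> g s" for s
        using u_le m lyapunov_nonneg by (auto simp: g_def indicator_def)
      show "integrable (?D (t + m)) (\<lambda>s. u * indicator (pile_up m ` E) s)"
        using u by (intro measure_pmf.integrable_const_bound[where B=u]) (auto simp: indicator_def)
    qed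
    finally show ?case .
  qed
  then have "?c \<le> 0"
    by (rule tendsto_lowerbound[OF LIMSEQ_ignore_initial_segment[OF lim]]) simp
  with \<open>0 < ?c\<close> show False by simp
qed

end

section \<open>From a violated bound to overload\<close>

theorem theorem5:
  fixes N M :: nat
    and lam p q :: "nat \<Rightarrow> real"
    and init :: "(nat \<Rightarrow> nat) pmf"
  assumes "1 \<le> N" and "1 \<le> M"
    and "\<And>n. n \<in> {1..N} \<Longrightarrow> 0 \<le> lam n \<and> lam n \<le> 1"
    and "\<And>n. n \<in> {1..N} \<Longrightarrow> 0 < p n \<and> p n < 1"
    and "\<And>n. n \<in> {1..N} \<Longrightarrow> 0 < q n \<and> q n \<le> 1"
    and "mono_on {1..N} (\<lambda>n. lam n * (1 - p n) / (alpha M (q n) * p n))"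
    and "system_stable N M lam p q init"
  shows "\<forall>k\<in>{1..N}.
    lam k \<le> alpha M (q k) * p k / (1 - p k) *
      ((\<Prod>j\<in>{k..N}. 1 - p j) -
       (if k = 1 then 0
        else (\<Sum>i\<in>{1..k-1}. lam i) / Max ((\<lambda>l. alpha M (q l)) ` {1..k-1})))"
proof (rule ballI, rule ccontr)
  fix k assume k: "k \<in> {1..N}"
  let ?max = "Max ((\<lambda>l. alpha M (q l)) ` {1..k-1})"
  let ?X = "if k = 1 then 0 else (\<Sum>i\<in>{1..k-1}. lam i) / ?max"
  assume neg: "\<not> lam k \<le> alpha M (q k) * p k / (1 - p k) * ((\<Prod>j\<in>{k..N}. 1 - p j) - ?X)"
  have a: "0 < alpha M (q n)" "rem (q n) M = 1 / alpha M (q n)" if "n \<in> {1..N}" for n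
    using assms(2) assms(5)[OF that] alpha_pos[of M "q n"] alpha_times_rem[of M "q n"]
    by (auto simp: field_simps)
  \<comment> \<open>Replacing the maximum by each source's own constant can only enlarge the sum, so
    a violated bound still gives \<open>overload\<close>.\<close>
  have "?X \<le> (\<Sum>i\<in>{1..<k}. lam i * rem (q i) M)"
  proof (cases "k = 1")
    case False
    then have eq: "{1..k-1} = {1..<k}" by auto
    have "?X = (\<Sum>i\<in>{1..<k}. lam i / ?max)"
      using False unfolding eq[symmetric] by (simp add: sum_divide_distrib)
    also have "\<dots> \<le> (\<Sum>i\<in>{1..<k}. lam i * rem (q i) M)"
    proof (rule sum_mono)
      fix i assume i: "i \<in> {1..<k}"
      then have iN: "i \<in> {1..N}" and le: "alpha M (q i) \<le> ?max" using k by (auto intro!: Max_ge)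
      have "lam i / ?max \<le> lam i / alpha M (q i)"
        using a(1)[OF iN] le assms(3)[OF iN] by (intro divide_left_mono) auto
      then show "lam i / ?max \<le> lam i * rem (q i) M"
        using a(2)[OF iN] by simp
    qed
    finally show ?thesis .
  qed simp
  moreover have "(\<Prod>j\<in>{k..N}. 1 - p j) - ?X < lam k * (1 - p k) / (alpha M (q k) * p k)"
    using neg a(1)[OF k] assms(4)[OF k] by (simp add: field_simps)
  moreover have "lam n * rem (q n) M * (1 - p n) / p n = lam n * (1 - p n) / (alpha M (q n) * p n)"
    if "n \<in> {1..N}" for n
    using a[OF that] by simp
  ultimately have "overload_at N M k lam p q"
    using assms k by unfold_locales (auto simp: mono_on_def)
  from overload_at.not_stable[OF this] assms(7) show False by blast
qed

end
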